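(* Let $C^{\overline{s}}$ be a constrained least-squares assignment (constrained LSA) of $X$ with site vector $\overline{s}\in\mathbb{R}^{d\cdot k}$, and let $\kappa^-,\kappa^+$ be cluster size bounds such that $\kappa^-\le|C^{\overline{s}}|\le\kappa^+$. The algorithm AlgoLSAtoRad (described in the context), applied to $(C^{\overline{s}},\overline{s},\kappa^-,\kappa^+)$, returns a sequence of clusterings $$(C^0,C^1,\dots,C^r)$$ and a sequence of power diagrams $$(P^0,\overline{P}^1,P^1,\dots,\overline{P}^r,P^r)$$ that satisfy the following properties: 1. $C^0=C^{\overline{s}}$; $C^r$ is a radial clustering for sites $\overline{s}$ (with respect to the bounds $\kappa^-,\kappa^+$). 2. All clusterings are constrained LSAs for sites $\overline{s}$. 3. All clusterings $C$ in the sequence have cluster sizes satisfying $\kappa_i^-\le|C_i|\le\kappa_i^+$ for all $i\le k$. 4. Consecutive clusterings differ by a single sequential exchange of items. 5. $P^i$ is a separating power diagram for sites $\overline{s}$ for $C^i$. 6. For each pair $C^{i-1},C^i$ of consecutive clusterings, $\overline{P}^i$ is a shared power diagram for sites $\overline{s}$. 7. The shapes $|C^i|$ are all distinct; the number of clusterings in the sequence is bounded by the number of (feasible) shapes.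
   Context: $X=\{x_1,\dots,x_n\}\subset\mathbb{R}^d$ is a finite set of $n$ distinct items with $\sum_{j=1}^n x_j=0$, and $[k]=\{1,\dots,k\}$. Clusterings. A clustering of $X$ is a partition $C=(C_1,\dots,C_k)$ of $X$ into $k$ (possibly empty) clusters. Its shape is $|C|:=(|C_1|,\dots,|C_k|)$; its clustering vector is $w(C):=(\sum_{x\in C_1}x,\dots,\sum_{x\in C_k}x)\in\mathbb{R}^{d\cdot k}$. Inequalities between shapes and bounds are componentwise; a shape is feasible if it lies between $\kappa^-$ and $\kappa^+$. Site vectors and constrained LSAs. A site vector is $a=(a_1^T,\dots,a_k^T)^T\in\mathbb{R}^{d\cdot k}$ with sites $a_i\in\mathbb{R}^d$. A clustering $C$ is a constrained LSA for $a$ if it minimizes $\sum_{i=1}^k\sum_{x\in C_i}\|x-a_i\|^2$ over all clusterings with the same shape as $C$. Polytopes and radial clusterings. For bounds $\kappa^-\le\kappa^+$ in $\mathbb{Z}_{\ge0}^k$, $\mathcal{P}^{\pm}(\kappa^-,\kappa^+)=\mathrm{conv}\{w(C):\kappa^-\le|C|\le\kappa^+\}$ (bounded-shape partition polytope) and $\mathcal{T}^{\pm}(\kappa^-,\kappa^+)=\{y\in\mathbb{R}^{n\cdot k}_{\ge 0}:\sum_i y_{ij}=1\ \forall j,\ \kappa_i^-\le\sum_j y_{ij}\le\kappa_i^+\ \forall i\}$ (bounded-shape transportation polytope). Write $\mathcal{T}^=(\kappa)=\mathcal{T}^{\pm}(\kappa,\kappa)$. The vertices of $\mathcal{T}^\pm$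 are exactly the 0/1-vectors $y$ of clusterings with sizes within the bounds ($y_{ij}=1$ iff $x_j\in C_i$), and are identified with these clusterings; clusterings are adjacent if the corresponding vertices share an edge of $\mathcal{T}^\pm$. For a site vector $a$ let $c(a)\in\mathbb{R}^{n\cdot k}$, $c(a)_{ij}=x_j^Ta_i$. A clustering $C$ within the bounds is radial for sites $a$ if $w(C)$ maximizes $a^Tw$ over $\mathcal{P}^{\pm}(\kappa^-,\kappa^+)$; equivalently, if its 0/1-vector maximizes $c(a)^Ty$ over $\mathcal{T}^{\pm}(\kappa^-,\kappa^+)$. Power diagrams. For a site vector $a$ and $\gamma_1,\dots,\gamma_k\in\mathbb{R}$, the power diagram with sites $a$ is $(P_1,\dots,P_k)$ with cells $P_i=\{x\in\mathbb{R}^d:(a_\ell-a_i)^Tx\le\gamma_\ell-\gamma_i\ \forall \ell\in[k]\setminus\{i\}\}$. It is a separating power diagram for $C$ if $C_i\subseteq P_i$ for all $i$, and a shared power diagram for two clusterings if it is separating for both. Exchanges. The clustering difference graph $CDG(C,C')$ is the labeled directed multigraph on $[k]$ with one arc $(i,\ell)$ labeled $x$ for each $i\ne\ell$ and $x\in C_i\cap C'_\ell$. $C$ and $C'$ differ by a single sequential exchange if, up to isolated nodes, $CDG(C,C')$ consists of a single directed path. AlgoLSAtoRad$(C,\overline{s},\kappa^-,\kappa^+)$, for a constrained LSA $C$ for sites $\overline{s}$: set $r=0$, $C^0=C$. While $C^r$ is not optimal in $\mathcal{T}^{\pm}(\kappa^-,\kappa^+)$ in direction $c(\overline{s})$: (i)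 perform an (improving) simplex step from $C^r$ with respect to $\max c(\overline{s})^Ty$ in $\mathcal{T}^{\pm}(\kappa^-,\kappa^+)$ to an adjacent vertex/clustering $C$; (ii) find a clustering optimal with respect to $c(\overline{s})$ in $\mathcal{T}^=(|C|)$ that differs from $C^r$ by a single sequential exchange, and let it be the next clustering $C^{r+1}$; increase $r$ by 1. For each clustering $C^i$ found, the power diagram $P^i$ with sites $\overline{s}$ is given by the values $\gamma$ of a solution of the LP: maximize $\varepsilon\ge0$ over $\gamma\in\mathbb{R}^k$ with $\gamma_1=0$ subject to $\frac{\max_{x\in C^i_h}(\overline{s}_\ell-\overline{s}_h)^Tx}{\|\overline{s}_\ell-\overline{s}_h\|}+\varepsilon\le\frac{\gamma_\ell-\gamma_h}{\|\overline{s}_\ell-\overline{s}_h\|}$ for all $h\ne\ell$. For each consecutive pair $C^{i-1},C^i$, the power diagram $\overline{P}^i$ with sites $\overline{s}$ is given by a $\gamma\in\mathbb{R}^k$ satisfying $\gamma_1=0$, $\max_{x\in C^{i}_h}(\overline{s}_\ell-\overline{s}_h)^Tx\le\gamma_\ell-\gamma_h$ and $\max_{x\in C^{i-1}_h}(\overline{s}_\ell-\overline{s}_h)^Tx\le\gamma_\ell-\gamma_h$ for all $h\ne\ell$. Return $(C^0,\dots,C^r)$ and $(P^0,\overline{P}^1,P^1,\dots,\overline{P}^r,P^r)$. *)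

theory Defs
  imports "HOL-Analysis.Analysis" "Graph_Theory.Arc_Walk"
begin

(* The space R^d is real^'d, clusters are labelled by the finite type 'k (with k = CARD('k)),
   items are enumerated by an injection x from the finite type 'n (with n = CARD('n)). *)

subsection \<open>Clusterings and constrained least-squares assignments\<close>

type_synonym ('d, 'k) clustering = "'k \<Rightarrow> (real^'d) set"

definition clustering :: "(real^'d) set \<Rightarrow> ('d, 'k) clustering \<Rightarrow> bool" where
  "clustering X C \<longleftrightarrow> (\<Union>i. C i) = X \<and> (\<forall>i l. i \<noteq> l \<longrightarrow> C i \<inter> C l = {})"

definition shape :: "('d, 'k) clustering \<Rightarrow> 'k \<Rightarrow> nat" where
  "shape C = (\<lambda>i. card (C i))"

(* Shapes and bounds are compared by the pointwise order on functions. *)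
definition bounded_clustering ::
    "(real^'d) set \<Rightarrow> ('k \<Rightarrow> nat) \<Rightarrow> ('k \<Rightarrow> nat) \<Rightarrow> ('d, 'k) clustering \<Rightarrow> bool" where
  "bounded_clustering X \<kappa>m \<kappa>p C \<longleftrightarrow> clustering X C \<and> \<kappa>m \<le> shape C \<and> shape C \<le> \<kappa>p"

definition feasible_shapes ::
    "(real^'d) set \<Rightarrow> ('k \<Rightarrow> nat) \<Rightarrow> ('k \<Rightarrow> nat) \<Rightarrow> ('k \<Rightarrow> nat) set" where
  "feasible_shapes X \<kappa>m \<kappa>p = {shape C | C. bounded_clustering X \<kappa>m \<kappa>p C}"

definition clustering_vector :: "('d::finite, 'k::finite) clustering \<Rightarrow> real^'d^'k" where
  "clustering_vector C = (\<chi> i. \<Sum>z\<in>C i. z)"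

definition lsa_cost :: "real^'d^'k \<Rightarrow> ('d::finite, 'k::finite) clustering \<Rightarrow> real" where
  "lsa_cost a C = (\<Sum>i\<in>UNIV. \<Sum>z\<in>C i. (norm (z - a $ i))\<^sup>2)"

definition constrained_LSA ::
    "(real^'d) set \<Rightarrow> real^'d^'k \<Rightarrow> ('d::finite, 'k::finite) clustering \<Rightarrow> bool" where
  "constrained_LSA X a C \<longleftrightarrow> clustering X C \<and>
     (\<forall>C'. clustering X C' \<and> shape C' = shape C \<longrightarrow> lsa_cost a C \<le> lsa_cost a C')"


subsection \<open>Partition and transportation polytopes\<close>

definition partition_polytope ::
    "(real^'d) set \<Rightarrow> ('k \<Rightarrow> nat) \<Rightarrow> ('k \<Rightarrow> nat) \<Rightarrow> (real^'d::finite^'k::finite) set" where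
  "partition_polytope X \<kappa>m \<kappa>p =
     convex hull {clustering_vector C | C. bounded_clustering X \<kappa>m \<kappa>p C}"

definition radial_clustering ::
    "(real^'d) set \<Rightarrow> ('k \<Rightarrow> nat) \<Rightarrow> ('k \<Rightarrow> nat) \<Rightarrow> real^'d^'k
      \<Rightarrow> ('d::finite, 'k::finite) clustering \<Rightarrow> bool" where
  "radial_clustering X \<kappa>m \<kappa>p a C \<longleftrightarrow> bounded_clustering X \<kappa>m \<kappa>p C \<and>
     (\<forall>w\<in>partition_polytope X \<kappa>m \<kappa>p. a \<bullet> w \<le> a \<bullet> clustering_vector C)"

definition transportation_polytope ::
    "('k \<Rightarrow> nat) \<Rightarrow> ('k \<Rightarrow> nat) \<Rightarrow> (real^'n::finite^'k::finite) set" where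
  "transportation_polytope \<kappa>m \<kappa>p =
     {y. (\<forall>i j. 0 \<le> y $ i $ j) \<and> (\<forall>j. (\<Sum>i\<in>UNIV. y $ i $ j) = 1) \<and>
         (\<forall>i. real (\<kappa>m i) \<le> (\<Sum>j\<in>UNIV. y $ i $ j) \<and> (\<Sum>j\<in>UNIV. y $ i $ j) \<le> real (\<kappa>p i))}"

definition assignment_vector ::
    "('n \<Rightarrow> real^'d) \<Rightarrow> ('d::finite, 'k::finite) clustering \<Rightarrow> real^'n::finite^'k" where
  "assignment_vector x C = (\<chi> i j. if x j \<in> C i then 1 else 0)"

definition site_objective ::
    "('n \<Rightarrow> real^'d) \<Rightarrow> real^'d::finite^'k::finite \<Rightarrow> real^'n::finite^'k" where
  "site_objective x a = (\<chi> i j. x j \<bullet> a $ i)"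

definition optimal_in :: "'v::real_inner set \<Rightarrow> 'v \<Rightarrow> 'v \<Rightarrow> bool" where
  "optimal_in T c y \<longleftrightarrow> y \<in> T \<and> (\<forall>z\<in>T. c \<bullet> z \<le> c \<bullet> y)"

definition adjacent_clusterings ::
    "('n::finite \<Rightarrow> real^'d) \<Rightarrow> ('k \<Rightarrow> nat) \<Rightarrow> ('k \<Rightarrow> nat)
      \<Rightarrow> ('d::finite, 'k::finite) clustering \<Rightarrow> ('d, 'k) clustering \<Rightarrow> bool" where
  "adjacent_clusterings x \<kappa>m \<kappa>p C D \<longleftrightarrow>
     bounded_clustering (range x) \<kappa>m \<kappa>p C \<and> bounded_clustering (range x) \<kappa>m \<kappa>p D \<and>
     closed_segment (assignment_vector x C) (assignment_vector x D)
       edge_of transportation_polytope \<kappa>m \<kappa>p"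


subsection \<open>Power diagrams\<close>

definition power_diagram :: "real^'d^'k \<Rightarrow> real^'k \<Rightarrow> 'k::finite \<Rightarrow> (real^'d::finite) set" where
  "power_diagram a \<gamma> i = {z. \<forall>l. l \<noteq> i \<longrightarrow> (a $ l - a $ i) \<bullet> z \<le> \<gamma> $ l - \<gamma> $ i}"

definition separating_power_diagram ::
    "real^'d^'k \<Rightarrow> ('k \<Rightarrow> (real^'d) set) \<Rightarrow> ('d::finite, 'k::finite) clustering \<Rightarrow> bool" where
  "separating_power_diagram a P C \<longleftrightarrow> (\<exists>\<gamma>. P = power_diagram a \<gamma>) \<and> (\<forall>i. C i \<subseteq> P i)"

definition shared_power_diagram ::
    "real^'d^'k \<Rightarrow> ('k \<Rightarrow> (real^'d) set)
      \<Rightarrow> ('d::finite, 'k::finite) clustering \<Rightarrow> ('d, 'k) clustering \<Rightarrow> bool" where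
  "shared_power_diagram a P C C' \<longleftrightarrow>
     separating_power_diagram a P C \<and> separating_power_diagram a P C'"


subsection \<open>Exchanges\<close>

(* An arc from i to l labelled z is the triple (i, z, l). *)
definition CDG ::
    "('d, 'k) clustering \<Rightarrow> ('d, 'k) clustering \<Rightarrow> ('k, 'k \<times> (real^'d) \<times> 'k) pre_digraph" where
  "CDG C C' =
     \<lparr>verts = UNIV,
      arcs = {(i, z, l) | i z l. i \<noteq> l \<and> z \<in> C i \<inter> C' l},
      tail = (\<lambda>(i, z, l). i),
      head = (\<lambda>(i, z, l). l)\<rparr>"

(* apath is a walk without repeated vertices; requiring that it uses all arcs leaves only
   isolated vertices outside of it. *)
definition single_sequential_exchange ::
    "('d::finite, 'k) clustering \<Rightarrow> ('d, 'k) clustering \<Rightarrow> bool" where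
  "single_sequential_exchange C C' \<longleftrightarrow>
     (\<exists>u p v. p \<noteq> [] \<and> pre_digraph.apath (CDG C C') u p v \<and> set p = arcs (CDG C C'))"


subsection \<open>The linear programs for the power diagrams\<close>

(* The label i1 plays the role of cluster 1 in the normalization gamma_1 = 0. A maximum over an
   empty cluster is minus infinity, so it imposes no constraint. For coinciding sites, where the
   normalized constraint would divide by zero, the constraint is read after multiplication by
   the norm of the difference of the sites. *)
definition margin_feasible ::
    "'k \<Rightarrow> real^'d^'k \<Rightarrow> ('d::finite, 'k::finite) clustering \<Rightarrow> real^'k \<Rightarrow> real \<Rightarrow> bool" where
  "margin_feasible i1 a C \<gamma> \<epsilon> \<longleftrightarrow> 0 \<le> \<epsilon> \<and> \<gamma> $ i1 = 0 \<and>
     (\<forall>h l. h \<noteq> l \<and> C h \<noteq> {} \<longrightarrow>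
        (if a $ l = a $ h then 0 \<le> \<gamma> $ l - \<gamma> $ h
         else Max ((\<lambda>z. (a $ l - a $ h) \<bullet> z) ` C h) / norm (a $ l - a $ h) + \<epsilon>
                \<le> (\<gamma> $ l - \<gamma> $ h) / norm (a $ l - a $ h)))"

(* The program is unbounded in degenerate cases (for instance if only one cluster is
   nonempty); then there is no optimum and any feasible gamma counts as a solution. *)
definition margin_solution ::
    "'k \<Rightarrow> real^'d^'k \<Rightarrow> ('d::finite, 'k::finite) clustering \<Rightarrow> real^'k \<Rightarrow> bool" where
  "margin_solution i1 a C \<gamma> \<longleftrightarrow>
     (\<exists>\<epsilon>. margin_feasible i1 a C \<gamma> \<epsilon> \<and>
        (bdd_above {\<epsilon>'. \<exists>\<gamma>'. margin_feasible i1 a C \<gamma>' \<epsilon>'} \<longrightarrow>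
           (\<forall>\<gamma>' \<epsilon>'. margin_feasible i1 a C \<gamma>' \<epsilon>' \<longrightarrow> \<epsilon>' \<le> \<epsilon>)))"

definition shared_feasible ::
    "'k \<Rightarrow> real^'d^'k \<Rightarrow> ('d::finite, 'k::finite) clustering \<Rightarrow> ('d, 'k) clustering
      \<Rightarrow> real^'k \<Rightarrow> bool" where
  "shared_feasible i1 a C C' \<gamma> \<longleftrightarrow> \<gamma> $ i1 = 0 \<and>
     (\<forall>h l. h \<noteq> l \<and> C' h \<noteq> {} \<longrightarrow> Max ((\<lambda>z. (a $ l - a $ h) \<bullet> z) ` C' h) \<le> \<gamma> $ l - \<gamma> $ h) \<and>
     (\<forall>h l. h \<noteq> l \<and> C h \<noteq> {} \<longrightarrow> Max ((\<lambda>z. (a $ l - a $ h) \<bullet> z) ` C h) \<le> \<gamma> $ l - \<gamma> $ h)"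


subsection \<open>The algorithm\<close>

definition clustering_optimal ::
    "('n::finite \<Rightarrow> real^'d) \<Rightarrow> real^'d^'k \<Rightarrow> ('k \<Rightarrow> nat) \<Rightarrow> ('k \<Rightarrow> nat)
      \<Rightarrow> ('d::finite, 'k::finite) clustering \<Rightarrow> bool" where
  "clustering_optimal x a \<kappa>m \<kappa>p C \<longleftrightarrow>
     optimal_in (transportation_polytope \<kappa>m \<kappa>p) (site_objective x a) (assignment_vector x C)"

definition simplex_step ::
    "('n::finite \<Rightarrow> real^'d) \<Rightarrow> real^'d^'k \<Rightarrow> ('k \<Rightarrow> nat) \<Rightarrow> ('k \<Rightarrow> nat)
      \<Rightarrow> ('d::finite, 'k::finite) clustering \<Rightarrow> ('d, 'k) clustering \<Rightarrow> bool" where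
  "simplex_step x a \<kappa>m \<kappa>p C D \<longleftrightarrow> adjacent_clusterings x \<kappa>m \<kappa>p C D \<and>
     site_objective x a \<bullet> assignment_vector x C < site_objective x a \<bullet> assignment_vector x D"

definition exchange_step ::
    "('n::finite \<Rightarrow> real^'d) \<Rightarrow> real^'d^'k \<Rightarrow> ('d::finite, 'k::finite) clustering
      \<Rightarrow> ('d, 'k) clustering \<Rightarrow> ('d, 'k) clustering \<Rightarrow> bool" where
  "exchange_step x a C D C' \<longleftrightarrow> clustering (range x) C' \<and>
     clustering_optimal x a (shape D) (shape D) C' \<and> single_sequential_exchange C C'"

(* Configurations of a run. The lists hold the clusterings C^0, ..., C^r and the diagrams
   P^0, Pbar^1, P^1, ..., Pbar^r, P^r found so far. *)
datatype ('c, 'p) config =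
    Start 'c
  | Loop "'c list" "'p list"
  | After_Simplex "'c list" "'p list" 'c
  | After_Exchange "'c list" "'p list" 'c
  | Return "'c list" "'p list"

(* The choices of the algorithm (adjacent vertex, clustering of the new shape, solutions of the
   linear programs) are nondeterministic. *)
inductive AlgoLSAtoRad ::
    "'k \<Rightarrow> ('n::finite \<Rightarrow> real^'d) \<Rightarrow> real^'d^'k \<Rightarrow> ('k \<Rightarrow> nat) \<Rightarrow> ('k \<Rightarrow> nat)
      \<Rightarrow> (('d::finite, 'k::finite) clustering, 'k \<Rightarrow> (real^'d) set) config
      \<Rightarrow> (('d, 'k) clustering, 'k \<Rightarrow> (real^'d) set) config \<Rightarrow> bool"
  for i1 x a \<kappa>m \<kappa>p where
  init: "margin_solution i1 a C \<gamma> \<Longrightarrow>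
    AlgoLSAtoRad i1 x a \<kappa>m \<kappa>p (Start C) (Loop [C] [power_diagram a \<gamma>])"
| simplex: "\<not> clustering_optimal x a \<kappa>m \<kappa>p (last Cs) \<Longrightarrow>
    simplex_step x a \<kappa>m \<kappa>p (last Cs) D \<Longrightarrow>
    AlgoLSAtoRad i1 x a \<kappa>m \<kappa>p (Loop Cs Ps) (After_Simplex Cs Ps D)"
| exchange: "exchange_step x a (last Cs) D C' \<Longrightarrow>
    AlgoLSAtoRad i1 x a \<kappa>m \<kappa>p (After_Simplex Cs Ps D) (After_Exchange Cs Ps C')"
| diagrams: "shared_feasible i1 a (last Cs) C' \<gamma>' \<Longrightarrow> margin_solution i1 a C' \<gamma> \<Longrightarrow>
    AlgoLSAtoRad i1 x a \<kappa>m \<kappa>p (After_Exchange Cs Ps C')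
      (Loop (Cs @ [C']) (Ps @ [power_diagram a \<gamma>', power_diagram a \<gamma>]))"
| stop: "clustering_optimal x a \<kappa>m \<kappa>p (last Cs) \<Longrightarrow>
    AlgoLSAtoRad i1 x a \<kappa>m \<kappa>p (Loop Cs Ps) (Return Cs Ps)"

end

(* Clusterings are maps from items to clusters, and a constrained LSA is a map of largest gain among
   those of its shape. A map that is optimal among all maps within size bounds admits no improving
   cyclic exchange, nor an improving path between clusters whose sizes may still change; hence the
   difference graph (with an additional hub node) has potentials. These potentials are cluster prices:
   they certify optimality over the whole transportation polytope, which gives its integrality, and
   they are the values gamma of a separating power diagram.

   Progress: among the improving maps within the bounds, one closest to the current map is adjacent to
   it. Conversely, an improving neighbour has a different shape, and splitting the passage to it along
   a path of the difference graph shows that one cluster shrinks and one grows, both by a single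
   item. Splitting the passage to an optimal map of the new shape in the same way yields an optimal
   map that is reached by a single sequential exchange. The objective strictly increases, and it is
   determined by the shape for constrained LSAs, so no shape occurs twice. *)
theory Submission
  imports Defs
begin

subsection \<open>Potentials of weighted digraphs\<close>

text \<open>The criterion for potentials is stated with permutations of the nodes instead of cycles.
  A permutation is a family of disjoint cycles, so all its exchanges can be carried out at once with
  at most one item leaving each cluster, and its effect on the sizes follows from bijectivity. The
  same criterion eliminates \<gamma> from the margin program. This makes the set of feasible margins
  closed, which is needed because a solution has to attain the optimum whenever the margins are
  bounded.

  Adjacency is known only geometrically, as a one-dimensional face. Hence both the existence of an
  improving neighbour and its change of sizes are obtained from the defining property of faces, the
  latter by exhibiting a second pair of 0/1 points with the same midpoint as the edge.

  A neighbour need not be optimal for its shape, so only its shape and its gain are carried over to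
  the next clustering. Since two sizes change by one, no third shape lies between the old and the
  new one; therefore a charge on a single cluster suffices to make the two maps optimal
  simultaneously.\<close>

fun path_weight :: "('v \<Rightarrow> 'v \<Rightarrow> real) \<Rightarrow> 'v list \<Rightarrow> real" where
  "path_weight w (u # v # vs) = w u v + path_weight w (v # vs)"
| "path_weight w _ = 0"

lemma path_weight_append:
  "path_weight w (us @ v # vs) = path_weight w (us @ [v]) + path_weight w (v # vs)"
  by (induction w us rule: path_weight.induct) auto

lemma path_weight_snoc:
  "us \<noteq> [] \<Longrightarrow> path_weight w (us @ [v]) = path_weight w us + w (last us) v"
  by (induction w us rule: path_weight.induct) auto

text \<open>For \<open>z = v\<close> the second list is the rotation of the first, and the sum is
  the weight of a closed walk.\<close>

lemma sum_list_shifted_weights: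
  "sum_list (map2 w (v # us) (us @ [z])) = path_weight w (v # us) + w (last (v # us)) z"
  by (induction us arbitrary: v) auto

lemma list_all2_shifted:
  "successively E (v # us) \<Longrightarrow> E (last (v # us)) z \<Longrightarrow> list_all2 E (v # us) (us @ [z])"
  by (induction us arbitrary: v) auto

text \<open>Rotating the cycle and fixing all other nodes is a permutation along \<open>E\<close>;
  the fixed nodes contribute loops of weight zero.\<close>

lemma simple_cycle_weight_le:
  fixes w :: "'v::finite \<Rightarrow> 'v \<Rightarrow> real"
  assumes E_refl: "\<And>v. E v v" and w_refl: "\<And>v. w v v = 0"
    and perm: "\<And>\<sigma>. bij \<sigma> \<Longrightarrow> (\<And>v. E v (\<sigma> v)) \<Longrightarrow> (\<Sum>v\<in>UNIV. w v (\<sigma> v)) \<le> 0"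
    and vs: "distinct vs" "vs \<noteq> []" "successively E vs" "E (last vs) (hd vs)"
  shows "path_weight w vs + w (last vs) (hd vs) \<le> 0"
proof -
  obtain v us where vs_eq: "vs = v # us" using vs(2) by (cases vs) auto
  define \<sigma> where "\<sigma> u = (case map_of (zip vs (rotate1 vs)) u of Some y \<Rightarrow> y | None \<Rightarrow> u)" for u
  have len: "length vs = length (rotate1 vs)" by simp
  have map_\<sigma>: "map \<sigma> vs = rotate1 vs"
  proof (rule nth_equalityI)
    fix i assume "i < length (map \<sigma> vs)"
    then have i: "i < length vs" by simp
    have "map_of (zip vs (rotate1 vs)) (vs ! i) = Some (rotate1 vs ! i)"
      by (rule map_of_zip_nth[OF len vs(1)]) (use i in auto)
    then show "map \<sigma> vs ! i = rotate1 vs ! i" using i by (simp add: \<sigma>_def)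
  qed simp
  have \<sigma>_out: "\<sigma> u = u" if "u \<notin> set vs" for u
  proof -
    have "map_of (zip vs (rotate1 vs)) u = None" using that len by simp
    then show ?thesis unfolding \<sigma>_def by (simp only: option.case)
  qed
  have "inj_on \<sigma> (set vs)"
    using vs(1) map_\<sigma> distinct_map[of \<sigma> vs] by simp
  moreover have "\<sigma> ` set vs = set vs"
    by (metis list.set_map map_\<sigma> set_rotate1)
  ultimately have "bij_betw \<sigma> (set vs) (set vs)" by (simp add: bij_betw_def)
  moreover have "bij_betw \<sigma> (- set vs) (- set vs)"
    using \<sigma>_out by (subst bij_betw_cong[where g = id]) auto
  ultimately have "bij_betw \<sigma> (set vs \<union> - set vs) (set vs \<union> - set vs)"
    by (rule bij_betw_combine) auto
  then have bij: "bij \<sigma>" by simp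
  have "list_all2 E vs (map \<sigma> vs)"
    unfolding map_\<sigma> using vs(3,4) list_all2_shifted[of E v us v] by (simp add: vs_eq)
  then have "\<forall>u\<in>set vs. E u (\<sigma> u)"
    by (simp add: list_all2_map2 list_all2_same)
  then have E: "E u (\<sigma> u)" for u using E_refl \<sigma>_out by (cases "u \<in> set vs") auto
  have "path_weight w vs + w (last vs) (hd vs) = sum_list (map2 w vs (map \<sigma> vs))"
    unfolding map_\<sigma> using sum_list_shifted_weights[of w v us v] by (simp add: vs_eq)
  also have "\<dots> = sum_list (map (\<lambda>u. w u (\<sigma> u)) vs)"
    by (simp add: map2_map_map[where f = "\<lambda>x. x", simplified])
  also have "\<dots> = (\<Sum>u\<in>set vs. w u (\<sigma> u))"
    using vs(1) by (simp add: sum_list_distinct_conv_sum_set)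
  also have "\<dots> = (\<Sum>u\<in>UNIV. w u (\<sigma> u))"
    by (rule sum.mono_neutral_left) (auto simp: \<sigma>_out w_refl)
  also have "\<dots> \<le> 0" by (rule perm[OF bij E])
  finally show ?thesis .
qed

text \<open>The potential of a node is the largest weight of a simple path ending there.\<close>

lemma potentials_exist:
  fixes w :: "'v::finite \<Rightarrow> 'v \<Rightarrow> real"
  assumes E_refl: "\<And>v. E v v" and w_refl: "\<And>v. w v v = 0"
    and perm: "\<And>\<sigma>. bij \<sigma> \<Longrightarrow> (\<And>v. E v (\<sigma> v)) \<Longrightarrow> (\<Sum>v\<in>UNIV. w v (\<sigma> v)) \<le> 0"
  shows "\<exists>p. \<forall>u v. E u v \<longrightarrow> p u + w u v \<le> p v"
proof -
  define Q where "Q v = {vs. distinct vs \<and> vs \<noteq> [] \<and> last vs = v \<and> successively E vs}" for v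
  define p where "p v = Max (path_weight w ` Q v)" for v
  have "Q v \<subseteq> {vs. set vs \<subseteq> UNIV \<and> distinct vs}" for v by (auto simp: Q_def)
  then have fin: "finite (Q v)" for v
    by (rule finite_subset) (rule finite_subset_distinct[OF finite])
  have ne: "[v] \<in> Q v" for v by (simp add: Q_def)
  have ge: "path_weight w vs \<le> p v" if "vs \<in> Q v" for vs v
    unfolding p_def using fin that by (intro Max_ge) auto
  have "p u + w u v \<le> p v" if uv: "E u v" for u v
  proof -
    have "p u \<in> path_weight w ` Q u"
      unfolding p_def using fin ne by (intro Max_in) auto
    then obtain vs where vs: "vs \<in> Q u" "p u = path_weight w vs" by auto
    show ?thesis
    proof (cases "v \<in> set vs")
      case False
      then have "vs @ [v] \<in> Q v"
        using vs(1) uv by (auto simp: Q_def successively_append_iff)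
      from ge[OF this] show ?thesis
        using vs by (simp add: Q_def path_weight_snoc)
    next
      case True
      \<comment> \<open>Appending \<open>v\<close> would repeat it. The path is cut at
        \<open>v\<close> instead: the part after it closes to a cycle through the arc from
        \<open>u\<close> to \<open>v\<close>, and dropping this cycle does not lower the
        weight.\<close>
      then obtain as bs where split: "vs = as @ v # bs" by (auto dest: split_list)
      have "as @ [v] \<in> Q v" using vs(1) by (auto simp: Q_def split successively_append_iff)
      from ge[OF this] have 1: "path_weight w (as @ [v]) \<le> p v" .
      have "path_weight w (v # bs) + w (last (v # bs)) (hd (v # bs)) \<le> 0"
        by (rule simple_cycle_weight_le[where E = E])
           (use E_refl w_refl perm vs(1) uv in \<open>auto simp: Q_def split successively_append_iff\<close>)
      moreover have "last (v # bs) = u" using vs(1) by (auto simp: Q_def split)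
      ultimately have "path_weight w (v # bs) + w u v \<le> 0" by (simp only: list.sel)
      then show ?thesis
        using 1 vs(2) path_weight_append[of w as v bs] by (simp add: split)
    qed
  qed
  then show ?thesis by blast
qed

text \<open>Potential differences cancel along a permutation. This converse of
  \<open>potentials_exist\<close> makes the criterion an equivalence, as needed for the closedness
  of the margins.\<close>

lemma potentials_imp_perm:
  fixes w :: "'v::finite \<Rightarrow> 'v \<Rightarrow> real"
  assumes "\<And>u v. E u v \<Longrightarrow> p u + w u v \<le> p v" and "bij \<sigma>" and "\<And>v. E v (\<sigma> v)"
  shows "(\<Sum>v\<in>UNIV. w v (\<sigma> v)) \<le> 0"
proof -
  have "(\<Sum>v\<in>UNIV. w v (\<sigma> v)) \<le> (\<Sum>v\<in>UNIV. p (\<sigma> v) - p v)"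
    by (rule sum_mono) (use assms(1,3) in \<open>auto simp: algebra_simps\<close>)
  also have "\<dots> = 0"
    using sum.reindex_bij_betw[OF assms(2), of p] by (simp add: sum_subtractf)
  finally show ?thesis .
qed

section \<open>Maps from items to clusters as 0/1 points of the transportation polytope\<close>

definition fibre_size :: "('n::finite \<Rightarrow> 'k) \<Rightarrow> 'k \<Rightarrow> nat" where
  "fibre_size f i = card (f -` {i})"

definition size_bounded :: "('k \<Rightarrow> nat) \<Rightarrow> ('k \<Rightarrow> nat) \<Rightarrow> ('n::finite \<Rightarrow> 'k) \<Rightarrow> bool" where
  "size_bounded \<kappa>m \<kappa>p f \<longleftrightarrow> \<kappa>m \<le> fibre_size f \<and> fibre_size f \<le> \<kappa>p"

definition gain :: "real^'n::finite^'k::finite \<Rightarrow> ('n \<Rightarrow> 'k) \<Rightarrow> real" where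
  "gain c f = (\<Sum>j\<in>UNIV. c $ f j $ j)"

definition incidence :: "('n \<Rightarrow> 'k) \<Rightarrow> real^'n::finite^'k::finite" where
  "incidence f = (\<chi> i j. if f j = i then 1 else 0)"

lemma incidence_nth [simp]: "incidence f $ i $ j = (if f j = i then 1 else 0)"
  by (simp add: incidence_def)

lemma inner_matrix: "(c::real^'n::finite^'k::finite) \<bullet> y = (\<Sum>i\<in>UNIV. \<Sum>j\<in>UNIV. c $ i $ j * y $ i $ j)"
  by (simp add: inner_vec_def)

lemma inner_incidence: "c \<bullet> incidence f = gain c f"
proof -
  have "c \<bullet> incidence f = (\<Sum>j\<in>UNIV. \<Sum>i\<in>UNIV. c $ i $ j * incidence f $ i $ j)"
    unfolding inner_matrix by (rule sum.swap)
  also have "\<dots> = gain c f"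
    unfolding gain_def
    by (intro sum.cong refl) (simp add: if_distrib[where f = "\<lambda>t. _ * t"] cong: if_cong)
  finally show ?thesis .
qed

lemma inj_incidence: "inj incidence"
proof (rule injI, rule ext)
  fix f g :: "'n::finite \<Rightarrow> 'k::finite" and j
  assume "incidence f = incidence g"
  then have "incidence f $ f j $ j = incidence g $ f j $ j" by simp
  then show "f j = g j" by (simp split: if_splits)
qed

lemma sum_by_fibres:
  fixes f :: "'n::finite \<Rightarrow> 'k::finite"
  shows "(\<Sum>i\<in>UNIV. \<Sum>j\<in>f -` {i}. h j) = (\<Sum>j\<in>UNIV. (h j :: real))"
  using sum.group[of UNIV UNIV f h] by (simp add: vimage_def)

lemma sum_comp_fibres:
  fixes f :: "'n::finite \<Rightarrow> 'k::finite"
  shows "(\<Sum>j\<in>UNIV. \<gamma> (f j)) = (\<Sum>i\<in>UNIV. \<gamma> i * real (fibre_size f i))"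
proof -
  have "(\<Sum>j\<in>UNIV. \<gamma> (f j)) = (\<Sum>i\<in>UNIV. \<Sum>j\<in>f -` {i}. \<gamma> (f j))"
    by (rule sum_by_fibres[symmetric])
  also have "\<dots> = (\<Sum>i\<in>UNIV. \<gamma> i * real (fibre_size f i))"
    by (intro sum.cong refl) (simp add: fibre_size_def mult.commute)
  finally show ?thesis .
qed

lemma sum_fibre_size:
  fixes f :: "'n::finite \<Rightarrow> 'k::finite"
  shows "(\<Sum>i\<in>UNIV. fibre_size f i) = CARD('n)"
proof -
  have "real (\<Sum>i\<in>UNIV. fibre_size f i) = real CARD('n)"
    using sum_comp_fibres[of "\<lambda>_. 1" f] by simp
  then show ?thesis by (simp only: of_nat_eq_iff)
qed

lemma row_sum_incidence: "(\<Sum>j\<in>UNIV. incidence f $ i $ j) = real (fibre_size f i)"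
proof -
  have "(\<Sum>j\<in>UNIV. incidence f $ i $ j) = (\<Sum>j\<in>{j. f j = i}. 1)"
    by (simp add: sum.If_cases)
  then show ?thesis by (simp add: fibre_size_def vimage_def)
qed

text \<open>Sizes are gains for indicator matrices, so an identity of gains that holds for every
  matrix also controls the sizes.\<close>

lemma fibre_size_as_gain: "real (fibre_size f l) = gain (\<chi> i j. if i = l then 1 else 0) f"
  using row_sum_incidence[of f l] by (simp add: gain_def)

lemma incidence_in_transportation_polytope:
  "incidence f \<in> transportation_polytope \<kappa>m \<kappa>p \<longleftrightarrow> size_bounded \<kappa>m \<kappa>p f"
proof -
  have "(\<Sum>i\<in>UNIV. incidence f $ i $ j) = 1" for j by simp
  moreover have "0 \<le> incidence f $ i $ j" for i j by simp
  ultimately show ?thesis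
    unfolding transportation_polytope_def size_bounded_def mem_Collect_eq row_sum_incidence
    by (auto simp: le_fun_def)
qed

subsection \<open>Optimality and cluster prices\<close>

text \<open>The potentials live on the clusters and an additional hub \<open>None\<close>: a permutation through the
  hub describes a path of exchanges that shrinks its first and enlarges its last cluster.\<close>

lemma optimal_prices:
  fixes c :: "real^'n::finite^'k::finite" and f :: "'n \<Rightarrow> 'k"
  assumes f: "size_bounded \<kappa>m \<kappa>p f"
    and opt: "\<And>g. size_bounded \<kappa>m \<kappa>p g \<Longrightarrow> gain c g \<le> gain c f"
  obtains \<gamma> where "\<And>i j. c $ i $ j - \<gamma> i \<le> c $ f j $ j - \<gamma> (f j)"
    and "\<And>i. fibre_size f i < \<kappa>p i \<Longrightarrow> \<gamma> i \<le> 0"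
    and "\<And>i. \<kappa>m i < fibre_size f i \<Longrightarrow> 0 \<le> \<gamma> i"
proof -
  \<comment> \<open>For each ordered pair of clusters, an item of \<open>h\<close> whose move to
    \<open>l\<close> changes the gain the most. An empty \<open>h\<close> gets an arbitrary
    item.\<close>
  have "\<exists>j. f -` {h} \<noteq> {} \<longrightarrow> f j = h \<and> (\<forall>j'. f j' = h \<longrightarrow> c $ l $ j' - c $ h $ j' \<le> c $ l $ j - c $ h $ j)"
    for h l
  proof (cases "f -` {h} = {}")
    case False
    define d where "d j = c $ l $ j - c $ h $ j" for j
    have "Max (d ` (f -` {h})) \<in> d ` (f -` {h})" using False by (intro Max_in) auto
    then obtain j where "f j = h" "d j = Max (d ` (f -` {h}))" by auto
    moreover have "d j' \<le> Max (d ` (f -` {h}))" if "f j' = h" for j'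
      using that by (intro Max_ge) auto
    ultimately show ?thesis unfolding d_def by metis
  qed auto
  then obtain J where J: "\<And>h l. f -` {h} \<noteq> {} \<Longrightarrow> f (J h l) = h"
    and J_max: "\<And>l j. c $ l $ j - c $ f j $ j \<le> c $ l $ J (f j) l - c $ f j $ J (f j) l"
    by (metis vimage_singleton_eq empty_iff)
  \<comment> \<open>An arc between distinct clusters stands for moving one item, so its tail must be
    nonempty. An arc into the hub ends a path at a cluster with room to grow; an arc out of the hub
    starts one at a cluster that may shrink.\<close>
  define E where "E u v = (case (u, v) of (Some h, Some l) \<Rightarrow> h = l \<or> f -` {h} \<noteq> {}
      | (Some l, None) \<Rightarrow> fibre_size f l < \<kappa>p l | (None, Some h) \<Rightarrow> \<kappa>m h < fibre_size f h
      | (None, None) \<Rightarrow> True)" for u v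
  define w where "w u v = (case (u, v) of (Some h, Some l) \<Rightarrow> c $ l $ J h l - c $ h $ J h l | _ \<Rightarrow> 0)"
    for u v
  have perm: "(\<Sum>v\<in>UNIV. w v (\<sigma> v)) \<le> 0" if bij: "bij \<sigma>" and E: "\<And>v. E v (\<sigma> v)" for \<sigma>
  proof -
    \<comment> \<open>All moves prescribed by \<sigma> at once: each cluster sends at most its one
      chosen item.\<close>
    define g where "g j = (case \<sigma> (Some (f j)) of Some l \<Rightarrow> (if j = J (f j) l then l else f j)
      | None \<Rightarrow> f j)" for j
    \<comment> \<open>Stated for every matrix \<open>b\<close>: \<open>c\<close> yields the change
      of the gain, indicator matrices yield the changes of the sizes.\<close>
    have change: "gain b g - gain b f =
        (\<Sum>h\<in>UNIV. case \<sigma> (Some h) of Some l \<Rightarrow> b $ l $ J h l - b $ h $ J h l | None \<Rightarrow> 0)"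
      for b :: "real^'n^'k"
    proof -
      have "gain b g - gain b f = (\<Sum>h\<in>UNIV. \<Sum>j\<in>f -` {h}. b $ g j $ j - b $ f j $ j)"
        unfolding sum_by_fibres by (simp add: gain_def sum_subtractf)
      also have "\<dots> = (\<Sum>h\<in>UNIV. case \<sigma> (Some h) of Some l \<Rightarrow> b $ l $ J h l - b $ h $ J h l | None \<Rightarrow> 0)"
      proof (rule sum.cong[OF refl])
        fix h
        show "(\<Sum>j\<in>f -` {h}. b $ g j $ j - b $ f j $ j) =
          (case \<sigma> (Some h) of Some l \<Rightarrow> b $ l $ J h l - b $ h $ J h l | None \<Rightarrow> 0)"
        proof (cases "\<sigma> (Some h)")
          case None
          then show ?thesis by (auto simp: g_def intro!: sum.neutral)
        next
          case (Some l)
          show ?thesis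
          proof (cases "l = h")
            case True
            then show ?thesis using Some by (auto simp: g_def intro!: sum.neutral)
          next
            case False
            then have "f -` {h} \<noteq> {}" using E[of "Some h"] Some by (simp add: E_def)
            then have "J h l \<in> f -` {h}" using J by simp
            then have "(\<Sum>j\<in>f -` {h}. b $ g j $ j - b $ f j $ j) = (\<Sum>j\<in>{J h l}. b $ g j $ j - b $ f j $ j)"
              using Some by (intro sum.mono_neutral_right) (auto simp: g_def)
            then show ?thesis using Some \<open>J h l \<in> f -` {h}\<close> by (simp add: g_def)
          qed
        qed
      qed
      finally show ?thesis .
    qed
    have "fibre_size g l \<in> {\<kappa>m l..\<kappa>p l}" for l
    proof -
      \<comment> \<open>Exactly one node precedes cluster \<open>l\<close> under \<sigma>. So
        \<open>l\<close> receives an item, possibly its own, unless this node is the hub, and it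
        gives one away unless its successor is the hub.\<close>
      have "(\<Sum>v\<in>UNIV. if \<sigma> v = Some l then 1 else 0 :: real) = (\<Sum>v\<in>UNIV. if v = Some l then 1 else 0)"
        by (rule sum.reindex_bij_betw[OF bij])
      then have "(\<Sum>v\<in>UNIV. if \<sigma> v = Some l then 1 else 0 :: real) = 1" by simp
      then have pre: "(\<Sum>h\<in>UNIV. if \<sigma> (Some h) = Some l then 1 else 0 :: real) = (if \<sigma> None = Some l then 0 else 1)"
        by (cases "\<sigma> None = Some l") (simp_all add: UNIV_option_conv sum.reindex)
      have "real (fibre_size g l) - real (fibre_size f l) =
        (\<Sum>h\<in>UNIV. (if \<sigma> (Some h) = Some l then 1 else 0) - (if h = l then (if \<sigma> (Some l) = None then 0 else 1) else 0))"
        unfolding fibre_size_as_gain change by (rule sum.cong[OF refl]) (auto split: option.splits)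
      also have "\<dots> = (if \<sigma> None = Some l then 0 else 1) - (if \<sigma> (Some l) = None then 0 else 1)"
        by (simp add: sum_subtractf pre)
      finally have diff: "real (fibre_size g l) = real (fibre_size f l) +
        (if \<sigma> None = Some l then 0 else 1) - (if \<sigma> (Some l) = None then 0 else 1)" by simp
      have "\<kappa>m l \<le> fibre_size f l" "fibre_size f l \<le> \<kappa>p l" using f by (auto simp: size_bounded_def le_fun_def)
      moreover have "\<sigma> None = Some l \<Longrightarrow> \<kappa>m l < fibre_size f l" using E[of None] by (simp add: E_def)
      moreover have "\<sigma> (Some l) = None \<Longrightarrow> fibre_size f l < \<kappa>p l" using E[of "Some l"] by (simp add: E_def)
      ultimately show ?thesis using diff by (auto split: if_splits)
    qed
    then have "size_bounded \<kappa>m \<kappa>p g" by (simp add: size_bounded_def le_fun_def)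
    from opt[OF this] have "gain c g - gain c f \<le> 0" by simp
    moreover have "(\<Sum>v\<in>UNIV. w v (\<sigma> v)) = gain c g - gain c f"
      unfolding change by (simp add: UNIV_option_conv sum.reindex w_def)
    ultimately show ?thesis by simp
  qed
  have "\<exists>p. \<forall>u v. E u v \<longrightarrow> p u + w u v \<le> p v"
    by (rule potentials_exist[OF _ _ perm]) (auto simp: E_def w_def split: option.splits)
  then obtain p where p: "\<And>u v. E u v \<Longrightarrow> p u + w u v \<le> p v" by blast
  \<comment> \<open>Measuring potentials relative to the hub turns the arcs at the hub into sign
    conditions on the prices.\<close>
  show ?thesis
  proof (rule that[of "\<lambda>i. p (Some i) - p None"])
    fix i j
    have "E (Some (f j)) (Some i)" by (auto simp: E_def)
    from p[OF this] J_max[of i j]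
    show "c $ i $ j - (p (Some i) - p None) \<le> c $ f j $ j - (p (Some (f j)) - p None)"
      by (simp add: w_def)
  next
    fix i assume "fibre_size f i < \<kappa>p i"
    then show "p (Some i) - p None \<le> 0" using p[of "Some i" None] by (simp add: E_def w_def)
  next
    fix i assume "\<kappa>m i < fibre_size f i"
    then show "0 \<le> p (Some i) - p None" using p[of None "Some i"] by (simp add: E_def w_def)
  qed
qed

text \<open>Weak duality with complementary slackness. The map \<open>f\<close> maximizes the
  reduced objective item by item. A positive price occurs only at a cluster of maximal size, a
  negative one only at a cluster of minimal size, so no admissible row sums give a larger price
  term.\<close>

lemma prices_optimal:
  fixes c :: "real^'n::finite^'k::finite" and f :: "'n \<Rightarrow> 'k"
  assumes f: "size_bounded \<kappa>m \<kappa>p f"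
    and price: "\<And>i j. c $ i $ j - \<gamma> i \<le> c $ f j $ j - \<gamma> (f j)"
    and up: "\<And>i. fibre_size f i < \<kappa>p i \<Longrightarrow> \<gamma> i \<le> 0"
    and low: "\<And>i. \<kappa>m i < fibre_size f i \<Longrightarrow> 0 \<le> \<gamma> i"
    and y: "y \<in> transportation_polytope \<kappa>m \<kappa>p"
  shows "c \<bullet> y \<le> gain c f"
proof -
  define Y where "Y i = (\<Sum>j\<in>UNIV. y $ i $ j)" for i
  have y0: "\<And>i j. 0 \<le> y $ i $ j" and y1: "\<And>j. (\<Sum>i\<in>UNIV. y $ i $ j) = 1"
    and Y: "\<And>i. real (\<kappa>m i) \<le> Y i" "\<And>i. Y i \<le> real (\<kappa>p i)"
    using y by (auto simp: transportation_polytope_def Y_def)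
  have "c \<bullet> y = (\<Sum>i\<in>UNIV. \<Sum>j\<in>UNIV. (c $ i $ j - \<gamma> i) * y $ i $ j) + (\<Sum>i\<in>UNIV. \<gamma> i * Y i)"
    by (simp add: inner_matrix Y_def sum_distrib_left flip: sum.distrib) (simp add: algebra_simps)
  also have "(\<Sum>i\<in>UNIV. \<Sum>j\<in>UNIV. (c $ i $ j - \<gamma> i) * y $ i $ j)
      \<le> (\<Sum>i\<in>UNIV. \<Sum>j\<in>UNIV. (c $ f j $ j - \<gamma> (f j)) * y $ i $ j)"
    by (intro sum_mono mult_right_mono price y0)
  also have "(\<Sum>i\<in>UNIV. \<Sum>j\<in>UNIV. (c $ f j $ j - \<gamma> (f j)) * y $ i $ j)
      = (\<Sum>j\<in>UNIV. c $ f j $ j - \<gamma> (f j))"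
    by (subst sum.swap) (simp add: y1 flip: sum_distrib_left)
  also have "(\<Sum>i\<in>UNIV. \<gamma> i * Y i) \<le> (\<Sum>i\<in>UNIV. \<gamma> i * real (fibre_size f i))"
  proof (rule sum_mono)
    fix i
    have b: "\<kappa>m i \<le> fibre_size f i" "fibre_size f i \<le> \<kappa>p i" using f by (auto simp: size_bounded_def le_fun_def)
    consider "\<gamma> i = 0" | "\<gamma> i < 0" "fibre_size f i = \<kappa>m i" | "\<gamma> i > 0" "fibre_size f i = \<kappa>p i"
      using b up[of i] low[of i] by fastforce
    then show "\<gamma> i * Y i \<le> \<gamma> i * real (fibre_size f i)"
      by cases (use Y[of i] in \<open>auto simp: mult_le_cancel_left\<close>)
  qed
  also have "(\<Sum>j\<in>UNIV. c $ f j $ j - \<gamma> (f j)) + (\<Sum>i\<in>UNIV. \<gamma> i * real (fibre_size f i)) = gain c f"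
    using sum_comp_fibres[of \<gamma> f] by (simp add: gain_def sum_subtractf)
  finally show ?thesis by simp
qed

lemma optimal_among_maps_imp_optimal:
  fixes c :: "real^'n::finite^'k::finite"
  assumes "size_bounded \<kappa>m \<kappa>p f" and "\<And>g. size_bounded \<kappa>m \<kappa>p g \<Longrightarrow> gain c g \<le> gain c f"
    and "y \<in> transportation_polytope \<kappa>m \<kappa>p"
  shows "c \<bullet> y \<le> gain c f"
  by (rule optimal_prices[OF assms(1,2)], assumption)
     (rule prices_optimal[OF assms(1) _ _ _ assms(3)])

section \<open>Integrality of the transportation polytope\<close>

lemma convex_transportation_polytope:
  "convex (transportation_polytope \<kappa>m \<kappa>p :: (real^'n::finite^'k::finite) set)"
proof (rule convexI)
  fix y z :: "real^'n^'k" and u v :: real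
  assume y: "y \<in> transportation_polytope \<kappa>m \<kappa>p" and z: "z \<in> transportation_polytope \<kappa>m \<kappa>p"
    and u: "0 \<le> u" "0 \<le> v" "u + v = 1"
  have "a \<le> u * p + v * q" if "a \<le> p" "a \<le> q" for a p q
  proof -
    have "u * a + v * a \<le> u * p + v * q" using that u by (intro add_mono mult_left_mono)
    then show ?thesis using u(3) by (simp flip: distrib_right)
  qed
  moreover have "u * p + v * q \<le> a" if "p \<le> a" "q \<le> a" for a p q
    using that u by (intro convex_bound_le)
  ultimately show "u *\<^sub>R y + v *\<^sub>R z \<in> transportation_polytope \<kappa>m \<kappa>p"
    using y z u by (auto simp: transportation_polytope_def sum.distrib simp flip: sum_distrib_left)
qed

lemma ex_optimal_map:
  fixes c :: "real^'n::finite^'k::finite"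
  assumes "P f\<^sub>0"
  obtains f where "P f" "\<And>g. P g \<Longrightarrow> gain c g \<le> gain c f"
proof -
  have "Max (gain c ` Collect P) \<in> gain c ` Collect P" using assms by (intro Max_in) auto
  then obtain f where "P f" "gain c f = Max (gain c ` Collect P)" by auto
  then show ?thesis by (intro that[of f]) (auto intro!: Max_ge)
qed

text \<open>A point of the polytope outside the hull could be strictly separated from it. A best map
  for the separating objective would then be beaten by that point, although its prices certify
  optimality over the whole polytope.\<close>

lemma transportation_polytope_eq_hull:
  fixes f\<^sub>0 :: "'n::finite \<Rightarrow> 'k::finite"
  assumes f0: "size_bounded \<kappa>m \<kappa>p f\<^sub>0"
  shows "transportation_polytope \<kappa>m \<kappa>p =
    convex hull (incidence ` {f :: 'n \<Rightarrow> 'k. size_bounded \<kappa>m \<kappa>p f})"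
proof (rule equalityI[rotated])
  show "convex hull (incidence ` {f :: 'n \<Rightarrow> 'k. size_bounded \<kappa>m \<kappa>p f}) \<subseteq> transportation_polytope \<kappa>m \<kappa>p"
    by (rule hull_minimal) (auto simp: incidence_in_transportation_polytope convex_transportation_polytope)
next
  show "transportation_polytope \<kappa>m \<kappa>p \<subseteq> convex hull (incidence ` {f :: 'n \<Rightarrow> 'k. size_bounded \<kappa>m \<kappa>p f})"
    (is "_ \<subseteq> ?H")
  proof (rule subsetI, rule ccontr)
    fix y :: "real^'n^'k" assume y: "y \<in> transportation_polytope \<kappa>m \<kappa>p" and "y \<notin> ?H"
    moreover have "closed ?H" by (intro compact_imp_closed finite_imp_compact_convex_hull) simp
    ultimately obtain a b where ab: "a \<bullet> y < b" "\<And>z. z \<in> ?H \<Longrightarrow> b < a \<bullet> z"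
      using separating_hyperplane_closed_point[of ?H y] convex_convex_hull by blast
    \<comment> \<open>The separating functional is smaller at \<open>y\<close> than on the hull,
      hence the sign change before maximizing.\<close>
    obtain f :: "'n \<Rightarrow> 'k" where f: "size_bounded \<kappa>m \<kappa>p f"
      "\<And>g. size_bounded \<kappa>m \<kappa>p g \<Longrightarrow> gain (- a) g \<le> gain (- a) f"
      using ex_optimal_map[of "size_bounded \<kappa>m \<kappa>p", OF f0] by blast
    have "(- a) \<bullet> y \<le> gain (- a) f"
      by (rule optimal_among_maps_imp_optimal[OF f y])
    moreover have "b < a \<bullet> incidence f" using f(1) by (intro ab(2) hull_inc) auto
    ultimately show False using ab(1) by (simp flip: inner_incidence)
  qed
qed

text \<open>Weights indexed by all maps, with zero outside the bounds, allow two convex combinations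
  to be merged term by term.\<close>

lemma mem_transportation_polytopeE:
  fixes f\<^sub>0 :: "'n::finite \<Rightarrow> 'k::finite"
  assumes "size_bounded \<kappa>m \<kappa>p f\<^sub>0" and p: "p \<in> transportation_polytope \<kappa>m \<kappa>p"
  obtains \<mu> :: "('n \<Rightarrow> 'k) \<Rightarrow> real" where "\<And>v. 0 \<le> \<mu> v" "(\<Sum>v\<in>UNIV. \<mu> v) = 1"
    "\<And>v. \<not> size_bounded \<kappa>m \<kappa>p v \<Longrightarrow> \<mu> v = 0" "p = (\<Sum>v\<in>UNIV. \<mu> v *\<^sub>R incidence v)"
proof -
  let ?W = "{f :: 'n \<Rightarrow> 'k. size_bounded \<kappa>m \<kappa>p f}"
  obtain u where u: "\<forall>x\<in>incidence ` ?W. 0 \<le> u x" "sum u (incidence ` ?W) = 1"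
    "(\<Sum>x\<in>incidence ` ?W. u x *\<^sub>R x) = p"
    using p unfolding transportation_polytope_eq_hull[OF assms(1)] by (auto simp: convex_hull_finite)
  have inj: "inj_on incidence ?W" using inj_incidence by (rule inj_on_subset) simp
  show ?thesis
  proof (rule that[of "\<lambda>v. if size_bounded \<kappa>m \<kappa>p v then u (incidence v) else 0"])
    show "(\<Sum>v\<in>UNIV. if size_bounded \<kappa>m \<kappa>p v then u (incidence v) else 0) = 1"
      using u(2) by (simp add: sum.reindex[OF inj] sum.If_cases)
    have "(\<Sum>v\<in>UNIV. (if size_bounded \<kappa>m \<kappa>p v then u (incidence v) else 0) *\<^sub>R incidence v)
      = (\<Sum>v\<in>?W. u (incidence v) *\<^sub>R (incidence v :: real^'n^'k))"
      by (rule sum.mono_neutral_cong_right) auto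
    then show "p = (\<Sum>v\<in>UNIV. (if size_bounded \<kappa>m \<kappa>p v then u (incidence v) else 0) *\<^sub>R incidence v)"
      using u(3) by (simp add: sum.reindex[OF inj])
  qed (use u(1) in auto)
qed

subsection \<open>Edges of the transportation polytope\<close>

text \<open>An improving map differing from \<open>f\<close> in as few places as possible spans an edge together with
  \<open>f\<close>: every other map in the face agrees with \<open>f\<close> or \<open>g\<close> everywhere, so it is closer to \<open>f\<close> and not
  improving, and comparing gains leaves no weight for it.\<close>

lemma improving_edge:
  fixes c :: "real^'n::finite^'k::finite"
  assumes f: "size_bounded \<kappa>m \<kappa>p f" and g0: "size_bounded \<kappa>m \<kappa>p g\<^sub>0" "gain c f < gain c g\<^sub>0"
  obtains g where "size_bounded \<kappa>m \<kappa>p g" "gain c f < gain c g"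
    "closed_segment (incidence f) (incidence g) edge_of transportation_polytope \<kappa>m \<kappa>p"
proof -
  define dist where "dist g = card {j. f j \<noteq> g j}" for g
  have "\<exists>g. (size_bounded \<kappa>m \<kappa>p g \<and> gain c f < gain c g) \<and>
    (\<forall>h. size_bounded \<kappa>m \<kappa>p h \<and> gain c f < gain c h \<longrightarrow> dist g \<le> dist h)"
    using g0 by (intro ex_has_least_nat[of _ g\<^sub>0]) auto
  then obtain g where g: "size_bounded \<kappa>m \<kappa>p g" "gain c f < gain c g"
    and least: "\<And>h. size_bounded \<kappa>m \<kappa>p h \<Longrightarrow> gain c f < gain c h \<Longrightarrow> dist g \<le> dist h" by blast
  have fg: "f \<noteq> g" using g(2) by auto
  let ?S = "closed_segment (incidence f) (incidence g)"
  let ?T = "transportation_polytope \<kappa>m \<kappa>p :: (real^'n^'k) set"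
  have inT: "incidence f \<in> ?T" "incidence g \<in> ?T"
    using f g by (simp_all add: incidence_in_transportation_polytope)
  have "p \<in> ?S \<and> q \<in> ?S" if pq: "p \<in> ?T" "q \<in> ?T" and z: "z \<in> ?S" "z \<in> open_segment p q" for p q z
  proof -
    obtain \<tau> where \<tau>: "0 \<le> \<tau>" "\<tau> \<le> 1" "z = (1 - \<tau>) *\<^sub>R incidence f + \<tau> *\<^sub>R incidence g"
      using z(1) by (auto simp: in_segment)
    obtain t where t: "0 < t" "t < 1" "z = (1 - t) *\<^sub>R p + t *\<^sub>R q"
      using z(2) by (auto simp: in_segment)
    obtain a where a: "\<And>v. 0 \<le> a v" "(\<Sum>v\<in>UNIV. a v) = 1" "\<And>v. \<not> size_bounded \<kappa>m \<kappa>p v \<Longrightarrow> a v = 0"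
      "p = (\<Sum>v\<in>UNIV. a v *\<^sub>R incidence v)"
      using mem_transportation_polytopeE[OF f pq(1)] by metis
    obtain b where b: "\<And>v. 0 \<le> b v" "(\<Sum>v\<in>UNIV. b v) = 1" "\<And>v. \<not> size_bounded \<kappa>m \<kappa>p v \<Longrightarrow> b v = 0"
      "q = (\<Sum>v\<in>UNIV. b v *\<^sub>R incidence v)"
      using mem_transportation_polytopeE[OF f pq(2)] by metis
    \<comment> \<open>The point \<open>z\<close> is now written in two ways: on the segment with
      parameter \<tau>, and as a convex combination of maps with weights \<nu>.\<close>
    define \<nu> where "\<nu> v = (1 - t) * a v + t * b v" for v
    have \<nu>0: "0 \<le> \<nu> v" for v using a(1) b(1) t by (simp add: \<nu>_def)
    have \<nu>1: "(\<Sum>v\<in>UNIV. \<nu> v) = 1"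
      using a(2) b(2) by (simp add: \<nu>_def sum.distrib flip: sum_distrib_left)
    have z_eq: "z = (\<Sum>v\<in>UNIV. \<nu> v *\<^sub>R incidence v)"
      by (simp add: t(3) a(4) b(4) \<nu>_def scaleR_add_left scaleR_sum_right sum.distrib)
    have coord: "z $ i $ j = (\<Sum>v\<in>UNIV. if v j = i then \<nu> v else 0)" for i j
      by (simp add: z_eq if_distrib cong: if_cong)
    \<comment> \<open>A coordinate where both \<open>f\<close> and \<open>g\<close> vanish is zero
      in \<open>z\<close>; as all weights are nonnegative, no map with positive weight uses
      it.\<close>
    have between: "v j = f j \<or> v j = g j" if "\<nu> v \<noteq> 0" for v j
    proof (rule ccontr)
      assume *: "\<not> ?thesis"
      then have "f j \<noteq> v j" "g j \<noteq> v j" by auto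
      then have "(\<Sum>u\<in>UNIV. if u j = v j then \<nu> u else 0) = 0"
        unfolding coord[symmetric] by (simp add: \<tau>(3))
      then have "\<forall>u\<in>UNIV. (if u j = v j then \<nu> u else 0) = 0"
        by (subst (asm) sum_nonneg_eq_0_iff) (simp_all add: \<nu>0)
      from bspec[OF this, of v] show False using that by simp
    qed
    have gain_le: "gain c v \<le> gain c f" if v: "\<nu> v \<noteq> 0" "v \<noteq> g" for v
    proof (rule ccontr)
      assume "\<not> ?thesis"
      moreover have "size_bounded \<kappa>m \<kappa>p v"
        by (rule ccontr) (use v(1) a(3)[of v] b(3)[of v] in \<open>simp add: \<nu>_def\<close>)
      ultimately have "dist g \<le> dist v" using least by simp
      moreover have "dist v < dist g"
        unfolding dist_def
      proof (rule psubset_card_mono)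
        obtain j where "v j \<noteq> g j" using v(2) by auto
        then have "v j = f j" using between[OF v(1), of j] by blast
        moreover have "f k \<noteq> g k" if "f k \<noteq> v k" for k using between[OF v(1), of k] that by auto
        ultimately have "j \<in> {j. f j \<noteq> g j} - {j. f j \<noteq> v j}" "{j. f j \<noteq> v j} \<subseteq> {j. f j \<noteq> g j}"
          using \<open>v j \<noteq> g j\<close> by auto
        then show "{j. f j \<noteq> v j} \<subset> {j. f j \<noteq> g j}" by blast
      qed simp
      ultimately show False by simp
    qed
    \<comment> \<open>Evaluating the objective at \<open>z\<close> in both ways: only
      \<open>g\<close> exceeds the gain of \<open>f\<close>, so it must carry at least the weight
      \<tau>.\<close>
    have "gain c f + \<tau> * (gain c g - gain c f) = c \<bullet> z"
      by (simp add: \<tau>(3) inner_add_right inner_incidence algebra_simps)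
    also have "\<dots> = (\<Sum>v\<in>UNIV. \<nu> v * gain c v)"
      by (simp add: z_eq inner_sum_right inner_incidence)
    also have "\<dots> \<le> (\<Sum>v\<in>UNIV. \<nu> v * gain c f + (if v = g then \<nu> g * (gain c g - gain c f) else 0))"
    proof (rule sum_mono)
      fix v show "\<nu> v * gain c v \<le> \<nu> v * gain c f + (if v = g then \<nu> g * (gain c g - gain c f) else 0)"
      proof (cases "\<nu> v = 0 \<or> v = g")
        case False
        then show ?thesis using gain_le[of v] \<nu>0[of v] by (simp add: mult_left_mono)
      qed (auto simp: algebra_simps)
    qed
    also have "\<dots> = gain c f + \<nu> g * (gain c g - gain c f)"
      by (simp add: sum.distrib \<nu>1 flip: sum_distrib_right)
    finally have "\<tau> \<le> \<nu> g" using g(2) by simp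
    \<comment> \<open>A third map with positive weight takes the value of \<open>g\<close> at some
      item where \<open>f\<close> does not. That coordinate of \<open>z\<close> equals \<tau>, but
      it would collect the weight of this map in addition to that of \<open>g\<close>.\<close>
    have no_other: "\<nu> v = 0" if v: "v \<noteq> f" "v \<noteq> g" for v
    proof (rule ccontr)
      assume nz: "\<nu> v \<noteq> 0"
      obtain j where j: "v j \<noteq> f j" using v(1) by auto
      then have "v j = g j" using between[OF nz] by blast
      then have "\<nu> v + \<nu> g = (\<Sum>u\<in>{v, g}. if u j = g j then \<nu> u else 0)" using v(2) by simp
      also have "\<dots> \<le> (\<Sum>u\<in>UNIV. if u j = g j then \<nu> u else 0)"
        by (rule sum_mono2) (auto simp: \<nu>0)
      also have "\<dots> = \<tau>"
        using j \<open>v j = g j\<close> by (simp add: coord[symmetric] \<tau>(3))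
      finally show False using \<open>\<tau> \<le> \<nu> g\<close> nz \<nu>0[of v] by simp
    qed
    have ab0: "a v = 0" "b v = 0" if v: "v \<notin> {f, g}" for v
    proof -
      have "(1 - t) * a v + t * b v = 0" using no_other[of v] v by (simp add: \<nu>_def)
      moreover have "0 \<le> (1 - t) * a v" "0 \<le> t * b v" using a(1) b(1) t by simp_all
      ultimately have "(1 - t) * a v = 0" "t * b v = 0" by linarith+
      then show "a v = 0" "b v = 0" using t by simp_all
    qed
    have "(\<Sum>v\<in>{f, g}. a v *\<^sub>R incidence v) = p" "(\<Sum>v\<in>{f, g}. a v) = 1"
      unfolding a(4) a(2)[symmetric] by (rule sum.mono_neutral_left; simp add: ab0)+
    then have "p = a f *\<^sub>R incidence f + a g *\<^sub>R incidence g" "a f = 1 - a g" using fg by simp_all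
    then have "p \<in> ?S" using a(1)[of f] a(1)[of g] by (auto simp: in_segment)
    have "(\<Sum>v\<in>{f, g}. b v *\<^sub>R incidence v) = q" "(\<Sum>v\<in>{f, g}. b v) = 1"
      unfolding b(4) b(2)[symmetric] by (rule sum.mono_neutral_left; simp add: ab0)+
    then have "q = b f *\<^sub>R incidence f + b g *\<^sub>R incidence g" "b f = 1 - b g" using fg by simp_all
    then have "q \<in> ?S" using b(1)[of f] b(1)[of g] by (auto simp: in_segment)
    with \<open>p \<in> ?S\<close> show ?thesis by simp
  qed
  moreover have "?S \<subseteq> ?T"
    by (rule closed_segment_subset[OF inT convex_transportation_polytope])
  ultimately have "?S face_of ?T" 
    unfolding face_of_def using convex_closed_segment by blast
  moreover have "incidence f \<noteq> incidence g" using fg inj_incidence by (auto dest: injD)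
  then have "aff_dim ?S = 1" by (simp add: segment_convex_hull aff_dim_convex_hull aff_dim_2)
  ultimately show ?thesis using that[OF g] by (simp add: edge_of_def)
qed

subsection \<open>Sequential exchanges between clusterings\<close>

definition clusters_of :: "('n \<Rightarrow> real^'d) \<Rightarrow> ('n \<Rightarrow> 'k) \<Rightarrow> ('d, 'k) clustering" where
  "clusters_of x f = (\<lambda>i. x ` (f -` {i}))"

lemma arcs_CDG_clusters_of:
  assumes "inj x"
  shows "arcs (CDG (clusters_of x f) (clusters_of x g)) = (\<lambda>j. (f j, x j, g j)) ` {j. f j \<noteq> g j}"
  using assms by (auto simp: CDG_def clusters_of_def dest: injD)

text \<open>Flow conservation along a walk; counted on a path of the difference graph, it gives the
  change of the cluster sizes.\<close>

lemma cas_degree: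
  assumes "pre_digraph.cas G u p v"
  shows "length (filter (\<lambda>e. tail G e = w) p) + of_bool (w = v)
    = length (filter (\<lambda>e. head G e = w) p) + of_bool (w = u)"
  using assms
proof (induction p arbitrary: u)
  case Nil
  then show ?case by (simp add: pre_digraph.cas.simps)
next
  case (Cons e p)
  then have "tail G e = u" "pre_digraph.cas G (head G e) p v" by (simp_all add: pre_digraph.cas.simps)
  with Cons.IH[of "head G e"] show ?case by auto
qed

lemma wf_digraph_CDG: "wf_digraph (CDG C D)"
  by unfold_locales (simp_all add: CDG_def)

lemma tail_CDG [simp]: "tail (CDG C D) = fst" and head_CDG [simp]: "head (CDG C D) = (\<lambda>e. snd (snd e))"
  by (auto simp: CDG_def)

lemma verts_CDG [simp]: "verts (CDG C D) = UNIV"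
  by (simp add: CDG_def)

text \<open>The ends of an arc are read off its triple, so a path found in one difference graph can
  be reused in another once its arcs are known to belong there.\<close>

lemma cas_CDG: "pre_digraph.cas (CDG C D) u p v = pre_digraph.cas (CDG C' D') u p v"
  by (induction p arbitrary: u) (simp_all add: pre_digraph.cas.simps)

lemma awalk_verts_CDG: "pre_digraph.awalk_verts (CDG C D) u p = pre_digraph.awalk_verts (CDG C' D') u p"
  by (induction p arbitrary: u) (simp_all add: pre_digraph.awalk_verts.simps)

text \<open>Switching \<open>f\<close> to \<open>g\<close> along a path of the difference graph splits the passage from \<open>f\<close> to \<open>g\<close>
  into two: \<open>h\<close> performs the path, \<open>h'\<close> all the rest.\<close>

lemma exchange_path:
  fixes f g :: "'n::finite \<Rightarrow> 'k::finite" and x :: "'n \<Rightarrow> real^'d::finite"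
  assumes x: "inj x" and i: "fibre_size g i < fibre_size f i"
  obtains l h h' where "fibre_size f l < fibre_size g l"
    "single_sequential_exchange (clusters_of x f) (clusters_of x h)"
    "\<And>w. fibre_size h w + of_bool (w = i) = fibre_size f w + of_bool (w = l)"
    "incidence h + incidence h' = incidence f + (incidence g :: real^'n^'k)"
proof -
  let ?G = "CDG (clusters_of x f) (clusters_of x g)"
  interpret wf_digraph ?G by (rule wf_digraph_CDG)
  note arcs = arcs_CDG_clusters_of[OF x]
  define R where "R = {l. i \<rightarrow>\<^sup>*\<^bsub>?G\<^esub> l}"
  have "i \<in> R" by (simp add: R_def)
  have closed: "g j \<in> R" if "f j \<in> R" for j
  proof (cases "f j = g j")
    case False
    then have "(f j, x j, g j) \<in> Digraph.arcs ?G" by (auto simp: arcs)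
    then have "f j \<rightarrow>\<^bsub>?G\<^esub> g j" by (auto simp: arcs_ends_def arc_to_ends_def intro!: image_eqI)
    then show ?thesis using that by (auto simp: R_def intro: reachable_adj_trans)
  qed (use that in simp)
  have size_R: "(\<Sum>u\<in>R. fibre_size k u) = card {j. k j \<in> R}" for k :: "'n \<Rightarrow> 'k"
  proof -
    have "{j. k j \<in> R} = (\<Union>u\<in>R. k -` {u})" by auto
    also have "card \<dots> = (\<Sum>u\<in>R. card (k -` {u}))" by (rule card_UN_disjoint) auto
    finally show ?thesis by (simp add: fibre_size_def)
  qed
  \<comment> \<open>Items of reachable clusters stay in reachable clusters, so the total size of
    \<open>R\<close> cannot drop. Since \<open>i\<close> shrinks, another cluster of
    \<open>R\<close> grows.\<close>
  have "\<exists>l\<in>R. fibre_size f l < fibre_size g l"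
  proof (rule ccontr)
    assume "\<not> ?thesis"
    then have "(\<Sum>u\<in>R. fibre_size g u) < (\<Sum>u\<in>R. fibre_size f u)"
      using i \<open>i \<in> R\<close> by (intro sum_strict_mono_ex1) (auto simp: not_less)
    moreover have "card {j. f j \<in> R} \<le> card {j. g j \<in> R}"
      using closed by (intro card_mono) auto
    ultimately show False by (simp add: size_R)
  qed
  then obtain l where l: "i \<rightarrow>\<^sup>*\<^bsub>?G\<^esub> l" "fibre_size f l < fibre_size g l" by (auto simp: R_def)
  then have "i \<noteq> l" using i by auto
  from l(1) obtain p where p: "apath i p l" by (auto simp: reachable_apath)
  have "p \<noteq> []" using p \<open>i \<noteq> l\<close> by (auto simp: apath_Nil_iff)
  have p_arcs: "set p \<subseteq> (\<lambda>j. (f j, x j, g j)) ` {j. f j \<noteq> g j}" and cas: "cas i p l"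
    and dist: "distinct (awalk_verts i p)"
    using p by (auto simp: apath_def awalk_def arcs)
  have "distinct p" using p cas dist by (auto simp: apath_def dest: distinct_verts_imp_distinct)
  define J where "J = {j. (f j, x j, g j) \<in> set p}"
  define h where "h j = (if j \<in> J then g j else f j)" for j
  define h' where "h' j = (if j \<in> J then f j else g j)" for j
  have p_J: "set p = (\<lambda>j. (f j, x j, g j)) ` J" using p_arcs by (auto simp: J_def)
  have J_ne: "f j \<noteq> g j" if "j \<in> J" for j
    using that p_arcs by (force simp: J_def dest: injD[OF x])
  have "Digraph.arcs (CDG (clusters_of x f) (clusters_of x h)) = set p"
    unfolding arcs p_J using J_ne by (auto simp: h_def)
  then have "pre_digraph.apath (CDG (clusters_of x f) (clusters_of x h)) i p l"
    unfolding pre_digraph.apath_def pre_digraph.awalk_def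
    using cas dist cas_CDG[of "clusters_of x f" "clusters_of x h" i p l "clusters_of x f" "clusters_of x g"]
      awalk_verts_CDG[of "clusters_of x f" "clusters_of x h" i p "clusters_of x f" "clusters_of x g"]
    by simp
  then have exch: "single_sequential_exchange (clusters_of x f) (clusters_of x h)"
    unfolding single_sequential_exchange_def
    using \<open>p \<noteq> []\<close> \<open>Digraph.arcs (CDG (clusters_of x f) (clusters_of x h)) = set p\<close> by blast
  \<comment> \<open>Labels identify items and \<open>p\<close> repeats no arc, so counting arcs of
    the path amounts to counting items of \<open>J\<close>.\<close>
  have count: "length (filter (\<lambda>e. t e = w) p) = card {j \<in> J. t (f j, x j, g j) = w}"
    for t :: "_ \<Rightarrow> 'k" and w
  proof -
    have "length (filter (\<lambda>e. t e = w) p) = card {e \<in> set p. t e = w}"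
      using \<open>distinct p\<close> by (metis distinct_card distinct_filter set_filter)
    also have "{e \<in> set p. t e = w} = (\<lambda>j. (f j, x j, g j)) ` {j \<in> J. t (f j, x j, g j) = w}"
      by (auto simp: p_J)
    also have "card \<dots> = card {j \<in> J. t (f j, x j, g j) = w}"
      by (rule card_image) (auto intro!: inj_onI dest: injD[OF x])
    finally show ?thesis .
  qed
  have sizes: "fibre_size h w + of_bool (w = i) = fibre_size f w + of_bool (w = l)" for w
  proof -
    have "card {j \<in> J. f j = w} + of_bool (w = l) = card {j \<in> J. g j = w} + of_bool (w = i)"
      using cas_degree[OF cas, of w] by (simp add: count)
    moreover have "fibre_size h w = card (f -` {w} - J) + card {j \<in> J. g j = w}"
      unfolding fibre_size_def
      by (subst card_Un_disjoint[symmetric]) (auto simp: h_def intro!: arg_cong[where f = card])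
    moreover have "fibre_size f w = card (f -` {w} - J) + card {j \<in> J. f j = w}"
      unfolding fibre_size_def
      by (subst card_Un_disjoint[symmetric]) (auto intro!: arg_cong[where f = card])
    ultimately show ?thesis by linarith
  qed
  have "incidence h + incidence h' = incidence f + (incidence g :: real^'n^'k)"
    by (auto simp: vec_eq_iff h_def h'_def)
  from that[OF l(2) exch sizes this] show ?thesis .
qed

text \<open>Gains and sizes are linear in the 0/1 point, so they inherit the splitting of the
  passage from \<open>f\<close> to \<open>g\<close>.\<close>

lemma incidence_add_eq:
  fixes h h' f g :: "'n::finite \<Rightarrow> 'k::finite"
  assumes "incidence h + incidence h' = incidence f + (incidence g :: real^'n^'k)"
  shows gain_add_eq: "gain c h + gain c h' = gain c f + gain c g"
    and fibre_size_add_eq: "fibre_size h w + fibre_size h' w = fibre_size f w + fibre_size g w"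
proof -
  show *: "gain c h + gain c h' = gain c f + gain c g" for c
    using arg_cong[OF assms, of "\<lambda>y. c \<bullet> y"] by (simp add: inner_add_right inner_incidence)
  have "real (fibre_size h w + fibre_size h' w) = real (fibre_size f w + fibre_size g w)"
    unfolding of_nat_add fibre_size_as_gain by (rule *)
  then show "fibre_size h w + fibre_size h' w = fibre_size f w + fibre_size g w" by (simp only: of_nat_eq_iff)
qed

text \<open>The sizes of either map sum to the number of items, so neither shape can strictly
  dominate the other.\<close>

lemma fibre_size_less_ex:
  fixes f g :: "'n::finite \<Rightarrow> 'k::finite"
  assumes "fibre_size f \<noteq> fibre_size g"
  obtains i where "fibre_size g i < fibre_size f i"
proof (rule ccontr)
  assume "\<not> thesis"
  then have le: "\<And>i. fibre_size f i \<le> fibre_size g i" using that by (meson not_less)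
  moreover obtain i where "fibre_size f i \<noteq> fibre_size g i" using assms by auto
  ultimately have "(\<Sum>i\<in>UNIV. fibre_size f i) < (\<Sum>i\<in>UNIV. fibre_size g i)"
    by (intro sum_strict_mono_ex1) (auto simp: order_less_le)
  then show False by (simp add: sum_fibre_size)
qed

text \<open>Both parts of the split passage respect the bounds and have the same midpoint as the
  edge. The face property puts \<open>h\<close> on the edge, where the only 0/1 points are the ends;
  as \<open>h\<close> differs from \<open>f\<close>, it is \<open>g\<close>, and its sizes are those
  after a single path.\<close>

lemma edge_sizes:
  fixes f g :: "'n::finite \<Rightarrow> 'k::finite" and x :: "'n \<Rightarrow> real^'d::finite"
  assumes x: "inj x" and f: "size_bounded \<kappa>m \<kappa>p f" and g: "size_bounded \<kappa>m \<kappa>p g"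
    and edge: "closed_segment (incidence f) (incidence g) edge_of transportation_polytope \<kappa>m \<kappa>p"
    and ne: "fibre_size f \<noteq> fibre_size g"
  obtains i l where "i \<noteq> l" "\<And>w. fibre_size g w + of_bool (w = i) = fibre_size f w + of_bool (w = l)"
proof -
  obtain i where i: "fibre_size g i < fibre_size f i" using fibre_size_less_ex[OF ne] .
  obtain l h h' where l: "fibre_size f l < fibre_size g l"
    and h: "\<And>w. fibre_size h w + of_bool (w = i) = fibre_size f w + of_bool (w = l)"
    and sum: "incidence h + incidence h' = incidence f + (incidence g :: real^'n^'k)"
    using exchange_path[OF x i] by metis
  have "i \<noteq> l" using i l by auto
  note h' = fibre_size_add_eq[OF sum]
  have b: "\<kappa>m w \<le> fibre_size f w" "fibre_size f w \<le> \<kappa>p w" "\<kappa>m w \<le> fibre_size g w" "fibre_size g w \<le> \<kappa>p w" for w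
    using f g by (auto simp: size_bounded_def le_fun_def)
  \<comment> \<open>The path changes only the sizes of \<open>i\<close> and \<open>l\<close>, each
    by one and towards its size under \<open>g\<close>. So the sizes of \<open>h\<close> and of
    \<open>h'\<close> lie between those of \<open>f\<close> and \<open>g\<close>.\<close>
  have "\<kappa>m w \<le> fibre_size h w \<and> fibre_size h w \<le> \<kappa>p w \<and> \<kappa>m w \<le> fibre_size h' w \<and> fibre_size h' w \<le> \<kappa>p w" for w
    using b[of w] h[of w] h'[of w] i l \<open>i \<noteq> l\<close> by (cases "w = i"; cases "w = l") auto
  then have "size_bounded \<kappa>m \<kappa>p h" "size_bounded \<kappa>m \<kappa>p h'" by (auto simp: size_bounded_def le_fun_def)
  then have inT: "incidence h \<in> transportation_polytope \<kappa>m \<kappa>p" "incidence h' \<in> transportation_polytope \<kappa>m \<kappa>p"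
    by (simp_all add: incidence_in_transportation_polytope)
  have "fibre_size h i \<noteq> fibre_size f i" using h[of i] \<open>i \<noteq> l\<close> by auto
  then have "h \<noteq> f" by auto
  \<comment> \<open>Parity: where \<open>f\<close> and \<open>g\<close> differ, their 0/1 points sum
    to one in a coordinate, which twice a 0/1 value cannot be.\<close>
  have "h \<noteq> h'"
  proof
    assume "h = h'"
    moreover obtain j where "f j \<noteq> g j" using ne by (metis ext)
    moreover have "incidence h $ f j $ j + incidence h' $ f j $ j = (incidence f $ f j $ j + incidence g $ f j $ j :: real)"
      using arg_cong[OF sum, of "\<lambda>y. y $ f j $ j"] by simp
    ultimately show False by (auto split: if_splits)
  qed
  then have ne': "(incidence h :: real^'n^'k) \<noteq> incidence h'" using inj_incidence by (auto dest: injD)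
  have "midpoint (incidence f) (incidence g :: real^'n^'k) = midpoint (incidence h) (incidence h')"
    by (simp add: midpoint_def sum)
  then have "midpoint (incidence f) (incidence g :: real^'n^'k) \<in> open_segment (incidence h) (incidence h')"
    using ne' by simp
  moreover have "midpoint (incidence f) (incidence g :: real^'n^'k) \<in> closed_segment (incidence f) (incidence g)"
    by simp
  ultimately have "incidence h \<in> closed_segment (incidence f) (incidence g :: real^'n^'k)"
    using edge inT unfolding edge_of_def face_of_def by blast
  then obtain u where u: "(incidence h :: real^'n^'k) = (1 - u) *\<^sub>R incidence f + u *\<^sub>R incidence g"
    by (auto simp: in_segment)
  \<comment> \<open>In the coordinate of the new cluster of \<open>j\<close>, the point of
    \<open>h\<close> is one and that of \<open>f\<close> is zero, which forces the segment parameter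
    to be one.\<close>
  obtain j where j: "h j \<noteq> f j" using \<open>h \<noteq> f\<close> by auto
  have "incidence h $ h j $ j = (1 - u) * incidence f $ h j $ j + u * incidence g $ h j $ j"
    using arg_cong[OF u, of "\<lambda>y. y $ h j $ j"] by simp
  then have "u = 1" using j by (auto split: if_splits)
  then have "(incidence h :: real^'n^'k) = incidence g" using u by simp
  then have "h = g" using inj_incidence by (auto dest: injD)
  then show ?thesis using that \<open>i \<noteq> l\<close> h by blast
qed

section \<open>Optimal maps of a shape: exchanges and common prices\<close>

definition shape_optimal :: "real^'n::finite^'k::finite \<Rightarrow> ('n \<Rightarrow> 'k) \<Rightarrow> bool" where
  "shape_optimal c f \<longleftrightarrow> (\<forall>g. fibre_size g = fibre_size f \<longrightarrow> gain c g \<le> gain c f)"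

lemma shape_optimal_prices:
  assumes "shape_optimal c f"
  obtains \<gamma> where "\<And>i j. c $ i $ j - \<gamma> i \<le> c $ f j $ j - \<gamma> (f j)"
  by (rule optimal_prices[of "fibre_size f" "fibre_size f" f c])
     (use assms in \<open>auto simp: shape_optimal_def size_bounded_def dest: antisym\<close>)

text \<open>Let \<open>b\<close> be any best map of the new shape. Following one path towards
  \<open>b\<close> gives \<open>h\<close> of the new shape, and the remaining exchanges give
  \<open>h'\<close> of the old one. The gains of \<open>h\<close> and \<open>h'\<close> sum to those
  of \<open>f\<close> and \<open>b\<close>; since \<open>h'\<close> cannot beat \<open>f\<close>,
  the map \<open>h\<close> is as good as \<open>b\<close>.\<close>

lemma exchange_exists:
  fixes f g :: "'n::finite \<Rightarrow> 'k::finite" and x :: "'n \<Rightarrow> real^'d::finite"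
  assumes x: "inj x" and f: "shape_optimal c f"
    and il: "i \<noteq> l" "\<And>w. fibre_size g w + of_bool (w = i) = fibre_size f w + of_bool (w = l)"
  obtains h where "fibre_size h = fibre_size g" "shape_optimal c h"
    "single_sequential_exchange (clusters_of x f) (clusters_of x h)"
proof -
  obtain b where b: "fibre_size b = fibre_size g" "\<And>h. fibre_size h = fibre_size g \<Longrightarrow> gain c h \<le> gain c b"
    using ex_optimal_map[of "\<lambda>h. fibre_size h = fibre_size g" g c] by blast
  have "fibre_size b i < fibre_size f i" using il(1) il(2)[of i] b(1) by simp
  then obtain l' h h' where l': "fibre_size f l' < fibre_size b l'"
    and ex: "single_sequential_exchange (clusters_of x f) (clusters_of x h)"
    and h: "\<And>w. fibre_size h w + of_bool (w = i) = fibre_size f w + of_bool (w = l')"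
    and sum: "incidence h + incidence h' = incidence f + (incidence b :: real^'n^'k)"
    using exchange_path[OF x, of b i f] by metis
  \<comment> \<open>Only \<open>l\<close> is larger in the new shape than in the old one, so the
    path has to end there.\<close>
  have "l' = l" using l' il(2)[of l'] b(1) by (auto split: if_splits simp: of_bool_def)
  then have "fibre_size h w = fibre_size g w" for w using h[of w] il(2)[of w] by simp
  then have hg: "fibre_size h = fibre_size g" ..
  then have "fibre_size h' w = fibre_size f w" for w
    using fibre_size_add_eq[OF sum, of w] b(1) by simp
  then have "gain c h' \<le> gain c f" using f unfolding shape_optimal_def by blast
  then have "gain c b \<le> gain c h" using gain_add_eq[OF sum, of c] by simp
  then have "shape_optimal c h" using b(2) hg unfolding shape_optimal_def by (auto intro: order_trans)
  then show ?thesis using that hg ex by blast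
qed

text \<open>Charging the difference of the two gains for every item of cluster \<open>l\<close> makes both maps optimal
  among the maps of either shape, so that prices of one of them are also prices of the other.\<close>

lemma shared_prices:
  fixes f g :: "'n::finite \<Rightarrow> 'k::finite"
  assumes f: "shape_optimal c f" and g: "shape_optimal c g"
    and il: "i \<noteq> l" "\<And>w. fibre_size g w + of_bool (w = i) = fibre_size f w + of_bool (w = l)"
  obtains \<gamma> where "\<And>i j. c $ i $ j - \<gamma> i \<le> c $ f j $ j - \<gamma> (f j)"
    "\<And>i j. c $ i $ j - \<gamma> i \<le> c $ g j $ j - \<gamma> (g j)"
proof -
  define \<delta> where "\<delta> = gain c g - gain c f"
  define b where "b = (\<chi> i j. c $ i $ j - (if i = l then \<delta> else 0))"
  have b_gain: "gain b h = gain c h - \<delta> * real (fibre_size h l)" for h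
    using sum_comp_fibres[of "\<lambda>i. if i = l then \<delta> else 0" h]
    by (simp add: gain_def b_def sum_subtractf if_distrib[where f = "\<lambda>t. t * _"] cong: if_cong)
  have fg_l: "fibre_size g l = fibre_size f l + 1" using il(1) il(2)[of l] by simp
  have b_eq: "gain b g = gain b f" by (simp add: b_gain fg_l \<delta>_def algebra_simps)
  define \<kappa>m where "\<kappa>m w = min (fibre_size f w) (fibre_size g w)" for w
  define \<kappa>p where "\<kappa>p w = max (fibre_size f w) (fibre_size g w)" for w
  have f_in: "size_bounded \<kappa>m \<kappa>p f" and g_in: "size_bounded \<kappa>m \<kappa>p g"
    by (auto simp: size_bounded_def le_fun_def \<kappa>m_def \<kappa>p_def)
  have opt: "gain b h \<le> gain b f" if h: "size_bounded \<kappa>m \<kappa>p h" for h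
  proof -
    have bd: "\<kappa>m w \<le> fibre_size h w" "fibre_size h w \<le> \<kappa>p w" for w
      using h by (auto simp: size_bounded_def le_fun_def)
    have off: "fibre_size h w = fibre_size f w \<and> fibre_size h w = fibre_size g w" if "w \<notin> {i, l}" for w
      using bd[of w] il(2)[of w] that by (simp add: \<kappa>m_def \<kappa>p_def)
    have split: "(\<Sum>w\<in>UNIV. fibre_size k w) = fibre_size k i + fibre_size k l + (\<Sum>w\<in>UNIV - {i, l}. fibre_size k w)"
      for k :: "'n \<Rightarrow> 'k"
      using il(1) by (subst sum.subset_diff[of "{i, l}"]) auto
    have "(\<Sum>w\<in>UNIV - {i, l}. fibre_size h w) = (\<Sum>w\<in>UNIV - {i, l}. fibre_size f w)"
      using off by (intro sum.cong) auto
    then have il_sum: "fibre_size h i + fibre_size h l = fibre_size f i + fibre_size f l"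
      using split[of h] split[of f] by (simp add: sum_fibre_size)
    \<comment> \<open>Sizes off \<open>i\<close> and \<open>l\<close> are forced, the total is
      fixed, and the bounds for \<open>l\<close> are consecutive integers. So the bounds admit
      exactly the two given shapes.\<close>
    consider "fibre_size h l = fibre_size f l" | "fibre_size h l = fibre_size g l"
      using bd[of l] fg_l by (fastforce simp: \<kappa>m_def \<kappa>p_def)
    then show ?thesis
    proof cases
      case 1
      then have "fibre_size h w = fibre_size f w" for w using off[of w] il_sum by (cases "w \<in> {i, l}") auto
      then have "fibre_size h = fibre_size f" ..
      then show ?thesis using f by (simp add: shape_optimal_def b_gain)
    next
      case 2
      then have "fibre_size h w = fibre_size g w" for w
        using off[of w] il_sum fg_l il(1) il(2)[of i] by (cases "w \<in> {i, l}") auto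
      then have "fibre_size h = fibre_size g" ..
      then have "gain b h \<le> gain b g" using g by (simp add: shape_optimal_def b_gain)
      then show ?thesis by (simp add: b_eq)
    qed
  qed
  obtain \<beta> where price: "\<And>i j. b $ i $ j - \<beta> i \<le> b $ f j $ j - \<beta> (f j)"
    and up: "\<And>i. fibre_size f i < \<kappa>p i \<Longrightarrow> \<beta> i \<le> 0" and low: "\<And>i. \<kappa>m i < fibre_size f i \<Longrightarrow> 0 \<le> \<beta> i"
    using optimal_prices[OF f_in opt] by blast
  have total: "gain b k = (\<Sum>j\<in>UNIV. b $ k j $ j - \<beta> (k j)) + (\<Sum>w\<in>UNIV. \<beta> w * real (fibre_size k w))"
    for k :: "'n \<Rightarrow> 'k"
    using sum_comp_fibres[of \<beta> k] by (simp add: gain_def sum_subtractf)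
  \<comment> \<open>The sign conditions favour the sizes of \<open>f\<close>. With equal gains, the
    reduced objective of \<open>g\<close> is thus at least that of \<open>f\<close>, which is
    maximal for each item; so equality holds item by item.\<close>
  have "(\<Sum>w\<in>UNIV. \<beta> w * real (fibre_size g w)) \<le> (\<Sum>w\<in>UNIV. \<beta> w * real (fibre_size f w))"
  proof (rule sum_mono)
    fix w
    show "\<beta> w * real (fibre_size g w) \<le> \<beta> w * real (fibre_size f w)"
      using up[of w] low[of w]
      by (cases "fibre_size f w" "fibre_size g w" rule: linorder_cases)
         (auto simp: \<kappa>m_def \<kappa>p_def mult_left_mono mult_left_mono_neg)
  qed
  then have "(\<Sum>j\<in>UNIV. (b $ f j $ j - \<beta> (f j)) - (b $ g j $ j - \<beta> (g j))) \<le> 0"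
    using total[of f] total[of g] b_eq by (simp only: sum_subtractf)
  moreover have nonneg: "0 \<le> (b $ f j $ j - \<beta> (f j)) - (b $ g j $ j - \<beta> (g j))" for j
    using price[of "g j" j] by simp
  ultimately have "(\<Sum>j\<in>UNIV. (b $ f j $ j - \<beta> (f j)) - (b $ g j $ j - \<beta> (g j))) = 0"
    by (intro antisym sum_nonneg)
  then have tight: "b $ f j $ j - \<beta> (f j) = b $ g j $ j - \<beta> (g j)" for j
    using nonneg by (subst (asm) sum_nonneg_eq_0_iff) auto
  \<comment> \<open>Moving the charge from the matrix into the price of \<open>l\<close> turns
    prices for \<open>b\<close> into prices for \<open>c\<close>.\<close>
  show ?thesis
  proof (rule that[of "\<lambda>w. \<beta> w + (if w = l then \<delta> else 0)"])
    fix i j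
    show "c $ i $ j - (\<beta> i + (if i = l then \<delta> else 0)) \<le> c $ f j $ j - (\<beta> (f j) + (if f j = l then \<delta> else 0))"
      using price[of i j] by (simp add: b_def algebra_simps)
    show "c $ i $ j - (\<beta> i + (if i = l then \<delta> else 0)) \<le> c $ g j $ j - (\<beta> (g j) + (if g j = l then \<delta> else 0))"
      using price[of i j] unfolding tight by (simp add: b_def algebra_simps)
  qed
qed

subsection \<open>Clusterings as maps\<close>

lemma clustering_clusters_of: "inj x \<Longrightarrow> clustering (range x) (clusters_of x f)"
  by (auto simp: clustering_def clusters_of_def dest: injD)

lemma clusteringE:
  assumes "clustering (range x) C"
  obtains f where "C = clusters_of x f"
proof -
  have "\<forall>j. \<exists>i. x j \<in> C i" using assms by (auto simp: clustering_def)
  then obtain f where f: "\<And>j. x j \<in> C (f j)" by metis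
  have "C i = clusters_of x f i" for i
  proof (rule set_eqI)
    fix z
    show "z \<in> C i \<longleftrightarrow> z \<in> clusters_of x f i"
    proof
      assume z: "z \<in> C i"
      then have "z \<in> (\<Union>i. C i)" by blast
      then have "z \<in> range x" using assms unfolding clustering_def by simp
      then obtain j where "z = x j" by blast
      moreover have "f j = i" using z f[of j] assms calculation by (auto simp: clustering_def)
      ultimately show "z \<in> clusters_of x f i" by (auto simp: clusters_of_def)
    qed (use f in \<open>auto simp: clusters_of_def\<close>)
  qed
  then show ?thesis using that by blast
qed

lemma shape_clusters_of: "inj x \<Longrightarrow> shape (clusters_of x f) = fibre_size f"
  by (auto simp: shape_def clusters_of_def fibre_size_def fun_eq_iff inj_on_def card_image dest: injD)

lemma bounded_clusters_of:
  "inj x \<Longrightarrow> bounded_clustering (range x) \<kappa>m \<kappa>p (clusters_of x f) \<longleftrightarrow> size_bounded \<kappa>m \<kappa>p f"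
  by (simp add: bounded_clustering_def size_bounded_def clustering_clusters_of shape_clusters_of)

lemma assignment_vector_clusters_of: "inj x \<Longrightarrow> assignment_vector x (clusters_of x f) = incidence f"
  by (auto simp: assignment_vector_def clusters_of_def vec_eq_iff dest: injD)

lemma sum_clusters_of:
  fixes x :: "'n::finite \<Rightarrow> real^'d" and f :: "'n \<Rightarrow> 'k::finite"
  assumes "inj x"
  shows "(\<Sum>i\<in>UNIV. \<Sum>z\<in>clusters_of x f i. (\<phi> i z :: real)) = (\<Sum>j\<in>UNIV. \<phi> (f j) (x j))"
proof -
  have "(\<Sum>i\<in>UNIV. \<Sum>z\<in>clusters_of x f i. \<phi> i z) = (\<Sum>i\<in>UNIV. \<Sum>j\<in>f -` {i}. \<phi> (f j) (x j))"
    unfolding clusters_of_def using assms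
    by (intro sum.cong refl) (auto simp: sum.reindex inj_on_def dest: injD)
  also have "\<dots> = (\<Sum>j\<in>UNIV. \<phi> (f j) (x j))" by (rule sum_by_fibres)
  finally show ?thesis .
qed

lemma gain_site_objective: "gain (site_objective x s) f = (\<Sum>j\<in>UNIV. x j \<bullet> s $ f j)"
  by (simp add: gain_def site_objective_def)

lemma inner_clustering_vector:
  "inj x \<Longrightarrow> s \<bullet> clustering_vector (clusters_of x f) = gain (site_objective x s) f"
  using sum_clusters_of[of x "\<lambda>i z. s $ i \<bullet> z" f]
  by (simp add: inner_vec_def[of s] clustering_vector_def inner_sum_right gain_site_objective inner_commute)

text \<open>Expanding the squares leaves a term fixed by the items, a term fixed by the shape, and
  the gain. Within a shape, least cost therefore means largest gain.\<close>

lemma lsa_cost_clusters_of: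
  assumes "inj x"
  shows "lsa_cost s (clusters_of x f) = (\<Sum>j\<in>UNIV. (norm (x j))\<^sup>2)
    + (\<Sum>i\<in>UNIV. (norm (s $ i))\<^sup>2 * real (fibre_size f i)) - 2 * gain (site_objective x s) f"
proof -
  have "lsa_cost s (clusters_of x f) = (\<Sum>j\<in>UNIV. (norm (x j - s $ f j))\<^sup>2)"
    unfolding lsa_cost_def by (rule sum_clusters_of[OF assms])
  also have "\<dots> = (\<Sum>j\<in>UNIV. (norm (x j))\<^sup>2 + (norm (s $ f j))\<^sup>2 - 2 * (x j \<bullet> s $ f j))"
    by (simp add: power2_norm_eq_inner inner_diff_left inner_diff_right inner_commute algebra_simps)
  also have "\<dots> = (\<Sum>j\<in>UNIV. (norm (x j))\<^sup>2) + (\<Sum>j\<in>UNIV. (norm (s $ f j))\<^sup>2)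
      - 2 * gain (site_objective x s) f"
    by (simp add: sum.distrib sum_subtractf gain_site_objective sum_distrib_left)
  finally show ?thesis by (simp add: sum_comp_fibres[of "\<lambda>i. (norm (s $ i))\<^sup>2"])
qed

lemma constrained_LSA_clusters_of:
  assumes "inj x"
  shows "constrained_LSA (range x) s (clusters_of x f) \<longleftrightarrow> shape_optimal (site_objective x s) f"
proof -
  have "constrained_LSA (range x) s (clusters_of x f) \<longleftrightarrow>
    (\<forall>g. fibre_size g = fibre_size f \<longrightarrow> lsa_cost s (clusters_of x f) \<le> lsa_cost s (clusters_of x g))"
    unfolding constrained_LSA_def
    using assms by (auto simp: clustering_clusters_of shape_clusters_of elim!: clusteringE)
  then show ?thesis by (auto simp: shape_optimal_def lsa_cost_clusters_of[OF assms])
qed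

text \<open>Comparison with maps suffices, because cluster prices extend it to the fractional
  points.\<close>

lemma clustering_optimal_clusters_of:
  assumes "inj x"
  shows "clustering_optimal x s \<kappa>m \<kappa>p (clusters_of x f) \<longleftrightarrow> size_bounded \<kappa>m \<kappa>p f \<and>
    (\<forall>g. size_bounded \<kappa>m \<kappa>p g \<longrightarrow> gain (site_objective x s) g \<le> gain (site_objective x s) f)"
  (is "?L \<longleftrightarrow> ?R")
proof
  assume ?L
  then have f: "size_bounded \<kappa>m \<kappa>p f"
    and le: "\<And>y. y \<in> transportation_polytope \<kappa>m \<kappa>p \<Longrightarrow> site_objective x s \<bullet> y \<le> gain (site_objective x s) f"
    by (auto simp: clustering_optimal_def optimal_in_def assignment_vector_clusters_of[OF assms]
        incidence_in_transportation_polytope inner_incidence)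
  have "gain (site_objective x s) g \<le> gain (site_objective x s) f" if "size_bounded \<kappa>m \<kappa>p g" for g
    using le[of "incidence g"] that by (simp add: incidence_in_transportation_polytope inner_incidence)
  with f show ?R by blast
next
  assume R: ?R
  then have "site_objective x s \<bullet> y \<le> gain (site_objective x s) f" if "y \<in> transportation_polytope \<kappa>m \<kappa>p" for y
    using that by (intro optimal_among_maps_imp_optimal) auto
  with R show ?L
    by (simp add: clustering_optimal_def optimal_in_def assignment_vector_clusters_of[OF assms]
        incidence_in_transportation_polytope inner_incidence)
qed

lemma clustering_optimal_shape:
  fixes f g :: "'n::finite \<Rightarrow> 'k::finite"
  assumes "inj x"
  shows "clustering_optimal x s (fibre_size g) (fibre_size g) (clusters_of x f) \<longleftrightarrow>
    fibre_size f = fibre_size g \<and> shape_optimal (site_objective x s) f"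
proof -
  have "size_bounded (fibre_size g) (fibre_size g) h \<longleftrightarrow> fibre_size h = fibre_size g" for h :: "'n \<Rightarrow> 'k"
    by (auto simp: size_bounded_def)
  then show ?thesis by (auto simp: clustering_optimal_clusters_of[OF assms] shape_optimal_def)
qed

lemma optimal_imp_radial:
  fixes x :: "'n::finite \<Rightarrow> real^'d::finite" and f :: "'n \<Rightarrow> 'k::finite"
  assumes x: "inj x" and opt: "clustering_optimal x s \<kappa>m \<kappa>p (clusters_of x f)"
  shows "radial_clustering (range x) \<kappa>m \<kappa>p s (clusters_of x f)"
proof -
  have "partition_polytope (range x) \<kappa>m \<kappa>p \<subseteq> {w. s \<bullet> w \<le> s \<bullet> clustering_vector (clusters_of x f)}"
    unfolding partition_polytope_def
  proof (rule hull_minimal)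
    show "{clustering_vector C |C. bounded_clustering (range x) \<kappa>m \<kappa>p C}
      \<subseteq> {w. s \<bullet> w \<le> s \<bullet> clustering_vector (clusters_of x f)}"
    proof clarify
      fix C :: "('d, 'k) clustering" assume C: "bounded_clustering (range x) \<kappa>m \<kappa>p C"
      then obtain g where "C = clusters_of x g" by (auto simp: bounded_clustering_def elim: clusteringE)
      then show "s \<bullet> clustering_vector C \<le> s \<bullet> clustering_vector (clusters_of x f)"
        using C opt by (simp add: bounded_clusters_of x clustering_optimal_clusters_of inner_clustering_vector)
    qed
  qed (rule convex_halfspace_le)
  moreover have "bounded_clustering (range x) \<kappa>m \<kappa>p (clusters_of x f)"
    using opt by (simp add: bounded_clusters_of x clustering_optimal_clusters_of)
  ultimately show ?thesis by (auto simp: radial_clustering_def)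
qed

lemma finite_feasible_shapes:
  "inj x \<Longrightarrow> finite (feasible_shapes (range (x :: 'n::finite \<Rightarrow> real^'d)) \<kappa>m (\<kappa>p :: 'k::finite \<Rightarrow> nat))"
proof (rule finite_subset)
  assume "inj x"
  then show "feasible_shapes (range x) \<kappa>m \<kappa>p \<subseteq> range (fibre_size :: ('n \<Rightarrow> 'k) \<Rightarrow> _)"
    by (auto simp: feasible_shapes_def bounded_clustering_def shape_clusters_of elim!: clusteringE)
qed simp

subsection \<open>Separating power diagrams\<close>

lemma subset_power_diagram_iff:
  assumes "\<And>i. finite (C i)"
  shows "(\<forall>i. C i \<subseteq> power_diagram a \<gamma> i) \<longleftrightarrow>
    (\<forall>h l. h \<noteq> l \<and> C h \<noteq> {} \<longrightarrow> Max ((\<lambda>z. (a $ l - a $ h) \<bullet> z) ` C h) \<le> \<gamma> $ l - \<gamma> $ h)"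
proof -
  have "(C h \<noteq> {} \<longrightarrow> Max ((\<lambda>z. (a $ l - a $ h) \<bullet> z) ` C h) \<le> t) \<longleftrightarrow> (\<forall>z\<in>C h. (a $ l - a $ h) \<bullet> z \<le> t)"
    for h l t
    using assms by (cases "C h = {}") simp_all
  then have "(\<forall>h l. h \<noteq> l \<and> C h \<noteq> {} \<longrightarrow> Max ((\<lambda>z. (a $ l - a $ h) \<bullet> z) ` C h) \<le> \<gamma> $ l - \<gamma> $ h) \<longleftrightarrow>
    (\<forall>h l. h \<noteq> l \<longrightarrow> (\<forall>z\<in>C h. (a $ l - a $ h) \<bullet> z \<le> \<gamma> $ l - \<gamma> $ h))"
    by blast
  moreover have "(\<forall>i. C i \<subseteq> power_diagram a \<gamma> i) \<longleftrightarrow>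
    (\<forall>h l. h \<noteq> l \<longrightarrow> (\<forall>z\<in>C h. (a $ l - a $ h) \<bullet> z \<le> \<gamma> $ l - \<gamma> $ h))"
    unfolding power_diagram_def subset_iff Ball_def mem_Collect_eq by metis
  ultimately show ?thesis by simp
qed

text \<open>The price inequalities of an item, rearranged, are the inequalities of its cell. The
  common shift \<open>t\<close> cancels in all differences and serves to normalize \<gamma> at
  \<open>i1\<close>.\<close>

lemma prices_power_diagram:
  assumes "\<And>i j. site_objective x s $ i $ j - \<gamma> i \<le> site_objective x s $ f j $ j - \<gamma> (f j)"
  shows "clusters_of x f i \<subseteq> power_diagram s (\<chi> i. \<gamma> i - t) i"
  using assms by (force simp: clusters_of_def power_diagram_def site_objective_def inner_diff_left
      inner_commute algebra_simps)

text \<open>Multiplied by the norm, the constraints of the margin program take the same form for equal and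
  for distinct sites.\<close>

lemma margin_feasible_iff:
  "margin_feasible i1 a C \<gamma> \<epsilon> \<longleftrightarrow> 0 \<le> \<epsilon> \<and> \<gamma> $ i1 = 0 \<and>
     (\<forall>h l. h \<noteq> l \<and> C h \<noteq> {} \<longrightarrow>
       \<gamma> $ h + (Max ((\<lambda>z. (a $ l - a $ h) \<bullet> z) ` C h) + \<epsilon> * norm (a $ l - a $ h)) \<le> \<gamma> $ l)"
proof -
  have "(if a $ l = a $ h then 0 \<le> \<gamma> $ l - \<gamma> $ h
         else Max ((\<lambda>z. (a $ l - a $ h) \<bullet> z) ` C h) / norm (a $ l - a $ h) + \<epsilon>
                \<le> (\<gamma> $ l - \<gamma> $ h) / norm (a $ l - a $ h)) \<longleftrightarrow>
     \<gamma> $ h + (Max ((\<lambda>z. (a $ l - a $ h) \<bullet> z) ` C h) + \<epsilon> * norm (a $ l - a $ h)) \<le> \<gamma> $ l"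
    if "C h \<noteq> {}" for h l
  proof (cases "a $ l = a $ h")
    case True
    then show ?thesis using that by (simp add: image_constant_conv)
  next
    case False
    then have "0 < norm (a $ l - a $ h)" by simp
    with False show ?thesis by (simp add: pos_le_divide_eq distrib_right) (simp add: algebra_simps)
  qed
  then show ?thesis by (auto simp: margin_feasible_def)
qed

lemma margin_solution_separating:
  assumes "\<And>i. finite (C i)" and "margin_solution i1 a C \<gamma>"
  shows "separating_power_diagram a (power_diagram a \<gamma>) C"
proof -
  obtain \<epsilon> where "0 \<le> \<epsilon>" "\<And>h l. h \<noteq> l \<Longrightarrow> C h \<noteq> {} \<Longrightarrow>
      \<gamma> $ h + (Max ((\<lambda>z. (a $ l - a $ h) \<bullet> z) ` C h) + \<epsilon> * norm (a $ l - a $ h)) \<le> \<gamma> $ l"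
    using assms(2) by (auto simp: margin_solution_def margin_feasible_iff)
  moreover from \<open>0 \<le> \<epsilon>\<close> have "0 \<le> \<epsilon> * norm (a $ l - a $ h)" for h l by simp
  ultimately have "\<forall>h l. h \<noteq> l \<and> C h \<noteq> {} \<longrightarrow> Max ((\<lambda>z. (a $ l - a $ h) \<bullet> z) ` C h) \<le> \<gamma> $ l - \<gamma> $ h"
    by (smt (verit))
  then show ?thesis
    unfolding subset_power_diagram_iff[OF assms(1), symmetric] by (auto simp: separating_power_diagram_def)
qed

lemma shared_feasible_iff:
  assumes "\<And>i. finite (C i)" "\<And>i. finite (C' i)"
  shows "shared_feasible i1 a C C' \<gamma> \<longleftrightarrow> \<gamma> $ i1 = 0 \<and>
    (\<forall>i. C' i \<subseteq> power_diagram a \<gamma> i) \<and> (\<forall>i. C i \<subseteq> power_diagram a \<gamma> i)"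
  by (simp only: shared_feasible_def subset_power_diagram_iff[of C, OF assms(1)]
      subset_power_diagram_iff[of C', OF assms(2)])

text \<open>By the potential criterion, feasibility of a margin amounts to finitely many linear inequalities,
  so the feasible margins form a closed set.\<close>

lemma closed_margins: "closed {\<epsilon>. \<exists>\<gamma>. margin_feasible i1 a C \<gamma> \<epsilon>}"
proof -
  \<comment> \<open>Only nonempty clusters impose constraints, so a permutation may move only those.
    For each of these finitely many permutations the resulting condition is linear in
    \<epsilon>.\<close>
  define S where "S = {\<sigma> :: 'a \<Rightarrow> 'a. bij \<sigma> \<and> (\<forall>v. v = \<sigma> v \<or> C v \<noteq> {})}"
  define w where "w \<epsilon> u v = (if u = v then 0
    else Max ((\<lambda>z. (a $ v - a $ u) \<bullet> z) ` C u) + \<epsilon> * norm (a $ v - a $ u))" for \<epsilon> u v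
  have "(\<exists>\<gamma>. margin_feasible i1 a C \<gamma> \<epsilon>) \<longleftrightarrow> 0 \<le> \<epsilon> \<and> (\<forall>\<sigma>\<in>S. (\<Sum>v\<in>UNIV. w \<epsilon> v (\<sigma> v)) \<le> 0)" for \<epsilon>
  proof (intro iffI conjI ballI; (elim exE conjE)?)
    fix \<gamma> assume *: "margin_feasible i1 a C \<gamma> \<epsilon>"
    then show "0 \<le> \<epsilon>" by (simp add: margin_feasible_def)
    fix \<sigma> assume "\<sigma> \<in> S"
    then show "(\<Sum>v\<in>UNIV. w \<epsilon> v (\<sigma> v)) \<le> 0"
      using * by (intro potentials_imp_perm[where p = "\<lambda>v. \<gamma> $ v" and E = "\<lambda>u v. u = v \<or> C u \<noteq> {}"])
        (auto simp: S_def w_def margin_feasible_iff)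
  next
    assume "0 \<le> \<epsilon>" and *: "\<forall>\<sigma>\<in>S. (\<Sum>v\<in>UNIV. w \<epsilon> v (\<sigma> v)) \<le> 0"
    have "\<exists>p. \<forall>u v. u = v \<or> C u \<noteq> {} \<longrightarrow> p u + w \<epsilon> u v \<le> p v"
      by (rule potentials_exist) (use * in \<open>auto simp: S_def w_def[of _ v v for v]\<close>)
    then obtain p where p: "\<And>u v. u = v \<or> C u \<noteq> {} \<Longrightarrow> p u + w \<epsilon> u v \<le> p v" by blast
    have "p h + (Max ((\<lambda>z. (a $ l - a $ h) \<bullet> z) ` C h) + \<epsilon> * norm (a $ l - a $ h)) \<le> p l"
      if "h \<noteq> l" "C h \<noteq> {}" for h l
      using p[of h l] that by (simp add: w_def)
    then have "margin_feasible i1 a C (\<chi> v. p v - p i1) \<epsilon>"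
      using \<open>0 \<le> \<epsilon>\<close> by (simp add: margin_feasible_iff)
    then show "\<exists>\<gamma>. margin_feasible i1 a C \<gamma> \<epsilon>" by blast
  qed
  then have "{\<epsilon>. \<exists>\<gamma>. margin_feasible i1 a C \<gamma> \<epsilon>} = {0..} \<inter> (\<Inter>\<sigma>\<in>S. {\<epsilon>. (\<Sum>v\<in>UNIV. w \<epsilon> v (\<sigma> v)) \<le> 0})"
    by auto
  moreover have "closed {\<epsilon>. (\<Sum>v\<in>UNIV. w \<epsilon> v (\<sigma> v)) \<le> 0}" for \<sigma>
  proof (rule closed_Collect_le)
    have "continuous_on UNIV (\<lambda>\<epsilon>. w \<epsilon> u v)" for u v
      by (cases "u = v") (auto simp: w_def intro!: continuous_intros)
    then show "continuous_on UNIV (\<lambda>\<epsilon>. \<Sum>v\<in>UNIV. w \<epsilon> v (\<sigma> v))" by (intro continuous_on_sum) auto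
  qed simp
  ultimately show ?thesis by (auto intro!: closed_Int closed_INT)
qed

text \<open>If the margins are bounded, closedness makes their supremum feasible; otherwise any
  feasible \<gamma> is accepted as a solution.\<close>

lemma margin_solution_exists:
  assumes "margin_feasible i1 a C \<gamma>\<^sub>0 \<epsilon>\<^sub>0"
  shows "\<exists>\<gamma>. margin_solution i1 a C \<gamma>"
proof (cases "bdd_above {\<epsilon>. \<exists>\<gamma>. margin_feasible i1 a C \<gamma> \<epsilon>}")
  case True
  let ?M = "{\<epsilon>. \<exists>\<gamma>. margin_feasible i1 a C \<gamma> \<epsilon>}"
  have "Sup ?M \<in> ?M" using assms True by (intro closed_contains_Sup closed_margins) auto
  then obtain \<gamma> where "margin_feasible i1 a C \<gamma> (Sup ?M)" by auto
  moreover have "\<epsilon> \<le> Sup ?M" if "margin_feasible i1 a C \<gamma>' \<epsilon>" for \<gamma>' \<epsilon>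
    using that True by (intro cSup_upper) auto
  ultimately show ?thesis unfolding margin_solution_def by blast
next
  case False
  then show ?thesis
    unfolding margin_solution_def using assms by (intro exI[of _ \<gamma>\<^sub>0] exI[of _ \<epsilon>\<^sub>0]) simp
qed

subsection \<open>Rounds of the algorithm\<close>

text \<open>As \<open>f\<close> is already best for its shape, an improving neighbour must have
  another shape, which makes the size change along the edge available.\<close>

lemma simplex_step_maps:
  fixes f g :: "'n::finite \<Rightarrow> 'k::finite" and x :: "'n \<Rightarrow> real^'d::finite"
  assumes x: "inj x" and f: "shape_optimal (site_objective x s) f"
    and step: "simplex_step x s \<kappa>m \<kappa>p (clusters_of x f) (clusters_of x g)"
  obtains i l where "size_bounded \<kappa>m \<kappa>p g" "gain (site_objective x s) f < gain (site_objective x s) g"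
    "i \<noteq> l" "\<And>w. fibre_size g w + of_bool (w = i) = fibre_size f w + of_bool (w = l)"
proof -
  have fg: "size_bounded \<kappa>m \<kappa>p f" "size_bounded \<kappa>m \<kappa>p g"
    "closed_segment (incidence f) (incidence g) edge_of transportation_polytope \<kappa>m \<kappa>p"
    and less: "gain (site_objective x s) f < gain (site_objective x s) g"
    using step by (auto simp: simplex_step_def adjacent_clusterings_def bounded_clusters_of[OF x]
        assignment_vector_clusters_of[OF x] inner_incidence)
  have "fibre_size f \<noteq> fibre_size g"
  proof
    assume "fibre_size f = fibre_size g"
    then have "gain (site_objective x s) g \<le> gain (site_objective x s) f"
      using f by (simp add: shape_optimal_def)
    with less show False by simp
  qed
  from edge_sizes[OF x fg this] that[OF fg(2) less] show ?thesis by metis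
qed

lemma simplex_step_exists:
  fixes x :: "'n::finite \<Rightarrow> real^'d::finite"
  assumes x: "inj x" and C: "bounded_clustering (range x) \<kappa>m \<kappa>p C"
    and not_opt: "\<not> clustering_optimal x s \<kappa>m \<kappa>p C"
  shows "\<exists>D. simplex_step x s \<kappa>m \<kappa>p C D"
proof -
  obtain f where f: "C = clusters_of x f" using C by (auto simp: bounded_clustering_def elim: clusteringE)
  have bf: "size_bounded \<kappa>m \<kappa>p f" using C by (simp add: f bounded_clusters_of x)
  obtain g0 where "size_bounded \<kappa>m \<kappa>p g0" "gain (site_objective x s) f < gain (site_objective x s) g0"
    using not_opt bf by (auto simp: f clustering_optimal_clusters_of x not_le)
  then obtain g where "size_bounded \<kappa>m \<kappa>p g" "gain (site_objective x s) f < gain (site_objective x s) g"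
    "closed_segment (incidence f) (incidence g) edge_of transportation_polytope \<kappa>m \<kappa>p"
    using improving_edge[OF bf] by metis
  then have "simplex_step x s \<kappa>m \<kappa>p C (clusters_of x g)"
    using bf by (simp add: f simplex_step_def adjacent_clusterings_def bounded_clusters_of
        assignment_vector_clusters_of inner_incidence x)
  then show ?thesis by blast
qed

lemma simplex_stepE:
  fixes x :: "'n::finite \<Rightarrow> real^'d::finite"
  assumes "inj x" and "constrained_LSA (range x) s C" and "simplex_step x s \<kappa>m \<kappa>p C D"
  obtains f g where "C = clusters_of x f" "D = clusters_of x g" "shape_optimal (site_objective x s) f"
proof -
  have "clustering (range x) C" "clustering (range x) D"
    using assms by (auto simp: simplex_step_def adjacent_clusterings_def bounded_clustering_def)
  then obtain f g where "C = clusters_of x f" "D = clusters_of x g" by (metis clusteringE)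
  then show ?thesis using that assms(2) by (simp add: constrained_LSA_clusters_of[OF assms(1)])
qed

lemma exchange_step_exists:
  fixes x :: "'n::finite \<Rightarrow> real^'d::finite"
  assumes x: "inj x" and C: "constrained_LSA (range x) s C" and D: "simplex_step x s \<kappa>m \<kappa>p C D"
  shows "\<exists>C'. exchange_step x s C D C'"
proof -
  obtain f g where fg: "C = clusters_of x f" "D = clusters_of x g"
    and f: "shape_optimal (site_objective x s) f" using simplex_stepE[OF x C D] .
  obtain i l where il: "i \<noteq> l" "\<And>w. fibre_size g w + of_bool (w = i) = fibre_size f w + of_bool (w = l)"
    using simplex_step_maps[OF x f D[unfolded fg]] by metis
  obtain h where "fibre_size h = fibre_size g" "shape_optimal (site_objective x s) h"
    "single_sequential_exchange (clusters_of x f) (clusters_of x h)"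
    using exchange_exists[OF x f il] .
  then have "exchange_step x s C D (clusters_of x h)"
    by (simp add: fg exchange_step_def clustering_clusters_of shape_clusters_of clustering_optimal_shape x)
  then show ?thesis by blast
qed

text \<open>Valid for whichever \<open>C'\<close> the exchange picks: it is optimal for the shape of
  \<open>D\<close>, hence within the bounds and at least as good as \<open>D\<close>, and it stands
  one shifted unit of size away from \<open>C\<close>.\<close>

lemma exchange_step_result:
  fixes x :: "'n::finite \<Rightarrow> real^'d::finite"
  assumes x: "inj x" and C: "constrained_LSA (range x) s C" and D: "simplex_step x s \<kappa>m \<kappa>p C D"
    and C': "exchange_step x s C D C'"
  shows "bounded_clustering (range x) \<kappa>m \<kappa>p C'" and "constrained_LSA (range x) s C'"
    and "site_objective x s \<bullet> assignment_vector x C < site_objective x s \<bullet> assignment_vector x C'"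
    and "\<exists>\<gamma>. shared_feasible i1 s C C' \<gamma>"
proof -
  obtain f g where fg: "C = clusters_of x f" "D = clusters_of x g"
    and f: "shape_optimal (site_objective x s) f" using simplex_stepE[OF x C D] .
  obtain i l where g: "size_bounded \<kappa>m \<kappa>p g" "gain (site_objective x s) f < gain (site_objective x s) g"
    and il: "i \<noteq> l" "\<And>w. fibre_size g w + of_bool (w = i) = fibre_size f w + of_bool (w = l)"
    using simplex_step_maps[OF x f D[unfolded fg]] by metis
  obtain h where h: "C' = clusters_of x h" using C' by (auto simp: exchange_step_def elim: clusteringE)
  have hg: "fibre_size h = fibre_size g" and h_opt: "shape_optimal (site_objective x s) h"
    using C' by (simp_all add: fg h exchange_step_def shape_clusters_of clustering_optimal_shape x)
  show "bounded_clustering (range x) \<kappa>m \<kappa>p C'"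
    using g(1) hg by (simp add: h bounded_clusters_of x size_bounded_def)
  show "constrained_LSA (range x) s C'" using h_opt by (simp add: h constrained_LSA_clusters_of x)
  have "gain (site_objective x s) g \<le> gain (site_objective x s) h"
    using h_opt hg by (simp add: shape_optimal_def)
  with g(2) show "site_objective x s \<bullet> assignment_vector x C < site_objective x s \<bullet> assignment_vector x C'"
    by (simp add: fg h assignment_vector_clusters_of x inner_incidence)
  have il': "\<And>w. fibre_size h w + of_bool (w = i) = fibre_size f w + of_bool (w = l)" using il(2) hg by simp
  obtain \<gamma> where \<gamma>: "\<And>i j. site_objective x s $ i $ j - \<gamma> i \<le> site_objective x s $ f j $ j - \<gamma> (f j)"
    "\<And>i j. site_objective x s $ i $ j - \<gamma> i \<le> site_objective x s $ h j $ j - \<gamma> (h j)"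
    using shared_prices[OF f h_opt il(1) il'] by metis
  have "shared_feasible i1 s C C' (\<chi> i. \<gamma> i - \<gamma> i1)"
    using prices_power_diagram[of x s \<gamma> f, OF \<gamma>(1)] prices_power_diagram[of x s \<gamma> h, OF \<gamma>(2)]
    by (subst shared_feasible_iff) (auto simp: fg h clusters_of_def)
  then show "\<exists>\<gamma>. shared_feasible i1 s C C' \<gamma>" ..
qed

lemma clustering_finite: "clustering (range (x :: 'n::finite \<Rightarrow> real^'d)) C \<Longrightarrow> finite (C i)"
  by (rule finite_subset[of _ "range x"]) (auto simp: clustering_def)

text \<open>Normalized prices of the assignment separate the clusters, so margin zero is feasible
  and the program has a solution.\<close>

lemma constrained_LSA_margin_solution:
  fixes x :: "'n::finite \<Rightarrow> real^'d::finite"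
  assumes x: "inj x" and C: "constrained_LSA (range x) s C"
  shows "\<exists>\<gamma>. margin_solution i1 s C \<gamma>"
proof -
  obtain f where f: "C = clusters_of x f" using C by (auto simp: constrained_LSA_def elim: clusteringE)
  then have opt: "shape_optimal (site_objective x s) f" using C by (simp add: constrained_LSA_clusters_of x)
  obtain \<gamma> where \<gamma>: "\<And>i j. site_objective x s $ i $ j - \<gamma> i \<le> site_objective x s $ f j $ j - \<gamma> (f j)"
    by (rule shape_optimal_prices[OF opt]) (rule that)
  have "\<forall>i. C i \<subseteq> power_diagram s (\<chi> i. \<gamma> i - \<gamma> i1) i"
    using prices_power_diagram[of x s \<gamma> f, OF \<gamma>] by (simp add: f)
  then have "margin_feasible i1 s C (\<chi> i. \<gamma> i - \<gamma> i1) 0"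
    by (subst (asm) subset_power_diagram_iff) (auto simp: margin_feasible_iff f clusters_of_def algebra_simps)
  then show ?thesis by (rule margin_solution_exists)
qed

lemma same_shape_same_objective:
  fixes x :: "'n::finite \<Rightarrow> real^'d::finite"
  assumes x: "inj x" and C: "constrained_LSA (range x) s C" and D: "constrained_LSA (range x) s D"
    and eq: "shape C = shape D"
  shows "site_objective x s \<bullet> assignment_vector x C = site_objective x s \<bullet> assignment_vector x D"
proof -
  obtain f g where fg: "C = clusters_of x f" "D = clusters_of x g"
    using C D by (metis constrained_LSA_def clusteringE)
  then have "shape_optimal (site_objective x s) f" "shape_optimal (site_objective x s) g"
    "fibre_size f = fibre_size g"
    using C D eq by (simp_all add: constrained_LSA_clusters_of shape_clusters_of x)
  then show ?thesis
    by (auto simp: fg assignment_vector_clusters_of x inner_incidence shape_optimal_def intro: antisym)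
qed

subsection \<open>Invariants of a run\<close>

text \<open>In \<open>Ps\<close>, the diagram of the \<open>i\<close>-th clustering has index
  \<open>2 * i\<close>, and the one shared with its predecessor has index \<open>2 * i - 1\<close>.
  The strict growth of the objective is recorded for all pairs, as needed to exclude repeated
  shapes.\<close>

definition run_ok ::
    "('n::finite \<Rightarrow> real^'d) \<Rightarrow> real^'d^'k \<Rightarrow> ('k \<Rightarrow> nat) \<Rightarrow> ('k \<Rightarrow> nat)
      \<Rightarrow> ('d::finite, 'k::finite) clustering \<Rightarrow> ('d, 'k) clustering list
      \<Rightarrow> ('k \<Rightarrow> (real^'d) set) list \<Rightarrow> bool" where
  "run_ok x s \<kappa>m \<kappa>p C\<^sub>0 Cs Ps \<longleftrightarrow>
     Cs \<noteq> [] \<and> length Ps = 2 * (length Cs - 1) + 1 \<and> hd Cs = C\<^sub>0 \<and>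
     (\<forall>C\<in>set Cs. bounded_clustering (range x) \<kappa>m \<kappa>p C \<and> constrained_LSA (range x) s C) \<and>
     (\<forall>i. 1 \<le> i \<and> i < length Cs \<longrightarrow> single_sequential_exchange (Cs ! (i - 1)) (Cs ! i)) \<and>
     (\<forall>i < length Cs. separating_power_diagram s (Ps ! (2 * i)) (Cs ! i)) \<and>
     (\<forall>i. 1 \<le> i \<and> i < length Cs \<longrightarrow>
        shared_power_diagram s (Ps ! (2 * i - 1)) (Cs ! (i - 1)) (Cs ! i)) \<and>
     sorted_wrt (\<lambda>C D. site_objective x s \<bullet> assignment_vector x C < site_objective x s \<bullet> assignment_vector x D) Cs"

lemma run_ok_append:
  assumes ok: "run_ok x s \<kappa>m \<kappa>p C\<^sub>0 Cs Ps"
    and C': "bounded_clustering (range x) \<kappa>m \<kappa>p C'" "constrained_LSA (range x) s C'"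
    and less: "site_objective x s \<bullet> assignment_vector x (last Cs) < site_objective x s \<bullet> assignment_vector x C'"
    and exch: "single_sequential_exchange (last Cs) C'"
    and P: "separating_power_diagram s P C'" and P': "shared_power_diagram s P' (last Cs) C'"
  shows "run_ok x s \<kappa>m \<kappa>p C\<^sub>0 (Cs @ [C']) (Ps @ [P', P])"
proof -
  have ne: "Cs \<noteq> []" and len: "length Ps = 2 * length Cs - 1" using ok by (auto simp: run_ok_def neq_Nil_conv)
  define n where "n = length Cs"
  have n: "length Cs = n" "0 < n" "length Ps = 2 * n - 1" "Cs ! (n - 1) = last Cs"
    using ne len by (simp_all add: n_def last_conv_nth)
  have sorted: "sorted_wrt (\<lambda>C D. site_objective x s \<bullet> assignment_vector x C < site_objective x s \<bullet> assignment_vector x D) Cs"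
    using ok by (simp add: run_ok_def)
  have "site_objective x s \<bullet> assignment_vector x C \<le> site_objective x s \<bullet> assignment_vector x (last Cs)"
    if C: "C \<in> set Cs" for C
  proof -
    obtain k where k: "k < n" "C = Cs ! k" using C by (auto simp: in_set_conv_nth n)
    show ?thesis
    proof (cases "k = n - 1")
      case False
      then have "k < n - 1" using k by simp
      then show ?thesis using sorted_wrt_nth_less[OF sorted, of k "n - 1"] k n by simp
    qed (use k n in simp)
  qed
  then have "sorted_wrt (\<lambda>C D. site_objective x s \<bullet> assignment_vector x C < site_objective x s \<bullet> assignment_vector x D) (Cs @ [C'])"
    using sorted less by (auto simp: sorted_wrt_append intro: le_less_trans)
  moreover have "single_sequential_exchange ((Cs @ [C']) ! (i - 1)) ((Cs @ [C']) ! i)"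
    if "1 \<le> i" "i < length (Cs @ [C'])" for i
  proof (cases "i = n")
    case True
    then show ?thesis using n exch by (simp add: nth_append)
  next
    case False
    then show ?thesis using ok that n by (auto simp: run_ok_def nth_append)
  qed
  moreover have "separating_power_diagram s ((Ps @ [P', P]) ! (2 * i)) ((Cs @ [C']) ! i)"
    if "i < length (Cs @ [C'])" for i
  proof (cases "i = n")
    case True
    \<comment> \<open>The old list has length \<open>2 * n - 1\<close>, so index
      \<open>2 * n\<close> is the second of the two appended diagrams.\<close>
    moreover have "\<not> 2 * n < length Ps" "2 * n - length Ps = 1" using n by linarith+
    then have "(Ps @ [P', P]) ! (2 * n) = P" by (simp add: nth_append)
    ultimately show ?thesis using n P by (simp add: nth_append)
  next
    case False
    then have "i < n" using that n by simp
    then show ?thesis using ok n by (auto simp: run_ok_def nth_append)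
  qed
  moreover have "shared_power_diagram s ((Ps @ [P', P]) ! (2 * i - 1)) ((Cs @ [C']) ! (i - 1)) ((Cs @ [C']) ! i)"
    if "1 \<le> i" "i < length (Cs @ [C'])" for i
  proof (cases "i = n")
    case True
    then show ?thesis using n P' by (simp add: nth_append)
  next
    case False
    then have "i < n" using that n by simp
    then show ?thesis using ok n that by (auto simp: run_ok_def nth_append)
  qed
  moreover have "length (Ps @ [P', P]) = 2 * (length (Cs @ [C']) - 1) + 1" using n by simp
  moreover have "hd (Cs @ [C']) = C\<^sub>0"
    "\<forall>C\<in>set (Cs @ [C']). bounded_clustering (range x) \<kappa>m \<kappa>p C \<and> constrained_LSA (range x) s C"
    using ok C' ne by (auto simp: run_ok_def)
  ultimately show ?thesis unfolding run_ok_def by blast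
qed

lemma run_ok_distinct:
  fixes x :: "'n::finite \<Rightarrow> real^'d::finite"
  assumes x: "inj x" and ok: "run_ok x s \<kappa>m \<kappa>p C\<^sub>0 Cs Ps"
  shows "distinct (map shape Cs)" and "length Cs \<le> card (feasible_shapes (range x) \<kappa>m \<kappa>p)"
proof -
  have lsa: "\<And>i. i < length Cs \<Longrightarrow> constrained_LSA (range x) s (Cs ! i)"
    and sorted: "sorted_wrt (\<lambda>C D. site_objective x s \<bullet> assignment_vector x C < site_objective x s \<bullet> assignment_vector x D) Cs"
    using ok by (auto simp: run_ok_def)
  have "shape (Cs ! i) \<noteq> shape (Cs ! j)" if "i < j" "j < length Cs" for i j
    using same_shape_same_objective[OF x lsa[of i] lsa[of j]] sorted_wrt_nth_less[OF sorted that] that by auto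
  then show dist: "distinct (map shape Cs)"
    by (auto simp: distinct_conv_nth) (metis linorder_neqE_nat)
  have "set (map shape Cs) \<subseteq> feasible_shapes (range x) \<kappa>m \<kappa>p"
    using ok by (auto simp: run_ok_def feasible_shapes_def)
  then have "card (set (map shape Cs)) \<le> card (feasible_shapes (range x) \<kappa>m \<kappa>p)"
    by (intro card_mono finite_feasible_shapes x)
  then show "length Cs \<le> card (feasible_shapes (range x) \<kappa>m \<kappa>p)"
    using distinct_card[OF dist] by simp
qed

text \<open>After the exchange the configuration no longer holds the simplex neighbour. Its
  existence is kept in the invariant because the bounds and the increase of the objective come from
  it.\<close>

fun config_ok ::
    "('n::finite \<Rightarrow> real^'d) \<Rightarrow> real^'d^'k \<Rightarrow> ('k \<Rightarrow> nat) \<Rightarrow> ('k \<Rightarrow> nat)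
      \<Rightarrow> ('d::finite, 'k::finite) clustering
      \<Rightarrow> (('d, 'k) clustering, 'k \<Rightarrow> (real^'d) set) config \<Rightarrow> bool" where
  "config_ok x s \<kappa>m \<kappa>p C\<^sub>0 (Start C) \<longleftrightarrow> C = C\<^sub>0"
| "config_ok x s \<kappa>m \<kappa>p C\<^sub>0 (Loop Cs Ps) \<longleftrightarrow> run_ok x s \<kappa>m \<kappa>p C\<^sub>0 Cs Ps"
| "config_ok x s \<kappa>m \<kappa>p C\<^sub>0 (After_Simplex Cs Ps D) \<longleftrightarrow> run_ok x s \<kappa>m \<kappa>p C\<^sub>0 Cs Ps \<and>
     simplex_step x s \<kappa>m \<kappa>p (last Cs) D"
| "config_ok x s \<kappa>m \<kappa>p C\<^sub>0 (After_Exchange Cs Ps C') \<longleftrightarrow> run_ok x s \<kappa>m \<kappa>p C\<^sub>0 Cs Ps \<and>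
     (\<exists>D. simplex_step x s \<kappa>m \<kappa>p (last Cs) D \<and> exchange_step x s (last Cs) D C')"
| "config_ok x s \<kappa>m \<kappa>p C\<^sub>0 (Return Cs Ps) \<longleftrightarrow> run_ok x s \<kappa>m \<kappa>p C\<^sub>0 Cs Ps \<and>
     clustering_optimal x s \<kappa>m \<kappa>p (last Cs)"

text \<open>A round has three transitions and adds one clustering, so with factor three every
  transition raises the rank. The number of feasible shapes bounds it, which gives
  termination.\<close>

fun config_rank :: "('c, 'p) config \<Rightarrow> nat" where
  "config_rank (Start C) = 0"
| "config_rank (Loop Cs Ps) = 3 * length Cs"
| "config_rank (After_Simplex Cs Ps D) = 3 * length Cs + 1"
| "config_rank (After_Exchange Cs Ps C') = 3 * length Cs + 2"
| "config_rank (Return Cs Ps) = 3 * length Cs + 1"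

lemma config_rank_step: "AlgoLSAtoRad i1 x s \<kappa>m \<kappa>p c c' \<Longrightarrow> config_rank c < config_rank c'"
  by (induction rule: AlgoLSAtoRad.induct) auto

lemma config_rank_le:
  fixes x :: "'n::finite \<Rightarrow> real^'d::finite"
  assumes "inj x" "config_ok x s \<kappa>m \<kappa>p C\<^sub>0 c"
  shows "config_rank c \<le> 3 * card (feasible_shapes (range x) \<kappa>m \<kappa>p) + 2"
proof -
  note le = run_ok_distinct(2)[OF assms(1)]
  show ?thesis using assms(2) by (cases c) (auto dest!: le)
qed

lemma run_ok_last:
  assumes "run_ok x s \<kappa>m \<kappa>p C\<^sub>0 Cs Ps"
  shows "bounded_clustering (range x) \<kappa>m \<kappa>p (last Cs)" "constrained_LSA (range x) s (last Cs)"
  using assms by (auto simp: run_ok_def)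

lemma config_ok_step:
  fixes x :: "'n::finite \<Rightarrow> real^'d::finite"
  assumes x: "inj x" and C\<^sub>0: "bounded_clustering (range x) \<kappa>m \<kappa>p C\<^sub>0" "constrained_LSA (range x) s C\<^sub>0"
    and step: "AlgoLSAtoRad i1 x s \<kappa>m \<kappa>p c c'" and ok: "config_ok x s \<kappa>m \<kappa>p C\<^sub>0 c"
  shows "config_ok x s \<kappa>m \<kappa>p C\<^sub>0 c'"
  using step ok
proof cases
  case (init C \<gamma>)
  have "finite (C\<^sub>0 i)" for i using C\<^sub>0(1) by (auto simp: bounded_clustering_def intro: clustering_finite)
  then have "separating_power_diagram s (power_diagram s \<gamma>) C\<^sub>0"
    using init ok by (auto intro: margin_solution_separating)
  then show ?thesis using init ok C\<^sub>0 by (auto simp: run_ok_def)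
next
  case (diagrams Cs C' \<gamma>' \<gamma> Ps)
  obtain D where run: "run_ok x s \<kappa>m \<kappa>p C\<^sub>0 Cs Ps" and D: "simplex_step x s \<kappa>m \<kappa>p (last Cs) D"
    "exchange_step x s (last Cs) D C'"
    using ok diagrams(1) by auto
  note res = exchange_step_result[OF x run_ok_last(2)[OF run] D]
  have fin: "finite (C' i)" "finite (last Cs i)" for i
    using res(1) run_ok_last(1)[OF run] by (auto simp: bounded_clustering_def intro: clustering_finite)
  have "separating_power_diagram s (power_diagram s \<gamma>) C'"
    using diagrams fin(1) by (auto intro: margin_solution_separating)
  moreover have "shared_power_diagram s (power_diagram s \<gamma>') (last Cs) C'"
    using diagrams(3) fin
    by (auto simp: shared_feasible_iff shared_power_diagram_def separating_power_diagram_def)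
  moreover have "single_sequential_exchange (last Cs) C'" using D(2) by (simp add: exchange_step_def)
  ultimately show ?thesis using run_ok_append[OF run res(1-3)] diagrams(2) by simp
qed auto

text \<open>Under the invariant every nondeterministic choice has a candidate: an improving
  neighbour, an optimal single exchange, and solutions of both linear programs.\<close>

lemma config_ok_progress:
  fixes x :: "'n::finite \<Rightarrow> real^'d::finite"
  assumes x: "inj x" and C\<^sub>0: "constrained_LSA (range x) s C\<^sub>0"
    and ok: "config_ok x s \<kappa>m \<kappa>p C\<^sub>0 c" and stuck: "\<nexists>c'. AlgoLSAtoRad i1 x s \<kappa>m \<kappa>p c c'"
  shows "\<exists>Cs Ps. c = Return Cs Ps"
proof (cases c)
  case (Start C)
  then show ?thesis
    using constrained_LSA_margin_solution[OF x C\<^sub>0, of i1] ok stuck AlgoLSAtoRad.init by fastforce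
next
  case (Loop Cs Ps)
  then have run: "run_ok x s \<kappa>m \<kappa>p C\<^sub>0 Cs Ps" using ok by simp
  show ?thesis
  proof (cases "clustering_optimal x s \<kappa>m \<kappa>p (last Cs)")
    case True
    then show ?thesis using Loop stuck AlgoLSAtoRad.stop by fastforce
  next
    case False
    then show ?thesis
      using simplex_step_exists[OF x run_ok_last(1)[OF run] False] Loop stuck AlgoLSAtoRad.simplex by fastforce
  qed
next
  case (After_Simplex Cs Ps D)
  then have run: "run_ok x s \<kappa>m \<kappa>p C\<^sub>0 Cs Ps" and D: "simplex_step x s \<kappa>m \<kappa>p (last Cs) D"
    using ok by simp_all
  show ?thesis
    using exchange_step_exists[OF x run_ok_last(2)[OF run] D] After_Simplex stuck AlgoLSAtoRad.exchange
    by fastforce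
next
  case (After_Exchange Cs Ps C')
  then obtain D where run: "run_ok x s \<kappa>m \<kappa>p C\<^sub>0 Cs Ps" and D: "simplex_step x s \<kappa>m \<kappa>p (last Cs) D"
    "exchange_step x s (last Cs) D C'"
    using ok by auto
  note res = exchange_step_result[OF x run_ok_last(2)[OF run] D]
  obtain \<gamma>' \<gamma> where "shared_feasible i1 s (last Cs) C' \<gamma>'" "margin_solution i1 s C' \<gamma>"
    using res(4) constrained_LSA_margin_solution[OF x res(2)] by metis
  then show ?thesis using After_Exchange stuck AlgoLSAtoRad.diagrams by fastforce
qed auto

theorem theorem2:
  fixes x :: "'n::finite \<Rightarrow> real^'d::finite"
    and s :: "real^'d^'k::finite"
    and C\<^sub>s :: "('d, 'k) clustering"
    and \<kappa>m \<kappa>p :: "'k \<Rightarrow> nat"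
    and i1 :: 'k
  assumes "inj x"
    and "(\<Sum>j\<in>UNIV. x j) = 0"
    and "constrained_LSA (range x) s C\<^sub>s"
    and "\<kappa>m \<le> shape C\<^sub>s" and "shape C\<^sub>s \<le> \<kappa>p"
  shows
    \<comment> \<open>termination: there is no infinite run\<close>
    "(\<nexists>f. f 0 = Start C\<^sub>s \<and> (\<forall>t::nat. AlgoLSAtoRad i1 x s \<kappa>m \<kappa>p (f t) (f (Suc t)))) \<and>
     \<comment> \<open>every step can be carried out: only returning configurations have no successor\<close>
     (\<forall>c. (AlgoLSAtoRad i1 x s \<kappa>m \<kappa>p)\<^sup>*\<^sup>* (Start C\<^sub>s) c \<and> (\<nexists>c'. AlgoLSAtoRad i1 x s \<kappa>m \<kappa>p c c')
        \<longrightarrow> (\<exists>Cs Ps. c = Return Cs Ps)) \<and>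
     \<comment> \<open>properties of the returned sequences\<close>
     (\<forall>Cs Ps. (AlgoLSAtoRad i1 x s \<kappa>m \<kappa>p)\<^sup>*\<^sup>* (Start C\<^sub>s) (Return Cs Ps) \<longrightarrow>
        Cs \<noteq> [] \<and> length Ps = 2 * (length Cs - 1) + 1 \<and>
        (hd Cs = C\<^sub>s \<and> radial_clustering (range x) \<kappa>m \<kappa>p s (last Cs)) \<and>
        (\<forall>C\<in>set Cs. constrained_LSA (range x) s C) \<and>
        (\<forall>C\<in>set Cs. \<forall>i. \<kappa>m i \<le> card (C i) \<and> card (C i) \<le> \<kappa>p i) \<and>
        (\<forall>i. 1 \<le> i \<and> i < length Cs \<longrightarrow> single_sequential_exchange (Cs ! (i - 1)) (Cs ! i)) \<and>
        (\<forall>i < length Cs. separating_power_diagram s (Ps ! (2 * i)) (Cs ! i)) \<and>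
        (\<forall>i. 1 \<le> i \<and> i < length Cs \<longrightarrow>
           shared_power_diagram s (Ps ! (2 * i - 1)) (Cs ! (i - 1)) (Cs ! i)) \<and>
        (distinct (map shape Cs) \<and> length Cs \<le> card (feasible_shapes (range x) \<kappa>m \<kappa>p)))"
proof -
  note x = \<open>inj x\<close>
  have C\<^sub>s: "bounded_clustering (range x) \<kappa>m \<kappa>p C\<^sub>s"
    using assms(3-5) by (simp add: bounded_clustering_def constrained_LSA_def)
  note step = config_ok_step[OF x C\<^sub>s assms(3)]
  have reach: "config_ok x s \<kappa>m \<kappa>p C\<^sub>s c" if "(AlgoLSAtoRad i1 x s \<kappa>m \<kappa>p)\<^sup>*\<^sup>* (Start C\<^sub>s) c" for c
    using that by (induction rule: rtranclp_induct) (auto intro: step)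
  have "\<nexists>f. f 0 = Start C\<^sub>s \<and> (\<forall>t::nat. AlgoLSAtoRad i1 x s \<kappa>m \<kappa>p (f t) (f (Suc t)))"
  proof (rule notI, elim exE conjE)
    fix f assume f: "f 0 = Start C\<^sub>s" "\<forall>t::nat. AlgoLSAtoRad i1 x s \<kappa>m \<kappa>p (f t) (f (Suc t))"
    have "config_ok x s \<kappa>m \<kappa>p C\<^sub>s (f t) \<and> t \<le> config_rank (f t)" for t
    proof (induction t)
      case (Suc t)
      then show ?case using f(2) step[of i1 "f t" "f (Suc t)"] config_rank_step[of i1 x s \<kappa>m \<kappa>p "f t" "f (Suc t)"]
        by auto
    qed (simp add: f(1))
    \<comment> \<open>After this many steps the rank exceeds its bound by at least one.\<close>
    from this[of "3 * card (feasible_shapes (range x) \<kappa>m \<kappa>p) + 3"] show False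
      using config_rank_le[OF x] by fastforce
  qed
  moreover have "\<exists>Cs Ps. c = Return Cs Ps"
    if "(AlgoLSAtoRad i1 x s \<kappa>m \<kappa>p)\<^sup>*\<^sup>* (Start C\<^sub>s) c" "\<nexists>c'. AlgoLSAtoRad i1 x s \<kappa>m \<kappa>p c c'" for c
    by (rule config_ok_progress[OF x assms(3) reach[OF that(1)] that(2)])
  moreover have "run_ok x s \<kappa>m \<kappa>p C\<^sub>s Cs Ps \<and> radial_clustering (range x) \<kappa>m \<kappa>p s (last Cs) \<and>
      distinct (map shape Cs) \<and> length Cs \<le> card (feasible_shapes (range x) \<kappa>m \<kappa>p)"
    if "(AlgoLSAtoRad i1 x s \<kappa>m \<kappa>p)\<^sup>*\<^sup>* (Start C\<^sub>s) (Return Cs Ps)" for Cs Ps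
  proof -
    have run: "run_ok x s \<kappa>m \<kappa>p C\<^sub>s Cs Ps" and opt: "clustering_optimal x s \<kappa>m \<kappa>p (last Cs)"
      using reach[OF that] by simp_all
    obtain f where "last Cs = clusters_of x f"
      using run_ok_last(2)[OF run] by (auto simp: constrained_LSA_def elim: clusteringE)
    then have "radial_clustering (range x) \<kappa>m \<kappa>p s (last Cs)" using optimal_imp_radial[OF x] opt by metis
    then show ?thesis using run run_ok_distinct[OF x run] by blast
  qed
  ultimately show ?thesis
    by (simp add: run_ok_def bounded_clustering_def shape_def le_fun_def)
qed

end
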